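(* Let $\rho_-<\rho_+$ be real numbers and let $f_1,\dots,f_N$ be a finite family of maps with $f_i\in\mathcal{P}^{\rho_+,\rho_-}$ for every $i$. Let $F=f_1\circ\dots\circ f_N$. Suppose that $F$ possesses a sequence $(\Gamma_k)_{k\in\mathbb{Z}}$ of invariant curves such that $\Gamma_k\uparrow+\infty$ uniformly as $k\to+\infty$ and $\Gamma_k\downarrow-\infty$ uniformly as $k\to-\infty$. Then for every $\omega\in(N\rho_-,N\rho_+)$ there exist two functions $\phi,\eta:\mathbb{R}\to\mathbb{R}$ satisfying, for every $t\in\mathbb{R}$, $$ \phi(t+1)=\phi(t)+1,\qquad \eta(t+1)=\eta(t), $$ $$ F(\phi(t),\eta(t))=(\phi(t+\omega),\eta(t+\omega)), $$ where $\phi$ is monotone (strictly monotone if $\omega\notin\mathbb{Q}$) and $\eta$ is of bounded variation.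
   Context: Let $\mathbb{T}=\mathbb{R}/\mathbb{Z}$. A diffeomorphism of the infinite cylinder $\mathbb{T}\times\mathbb{R}$ isotopic to the identity is written, passing to a lift to $\mathbb{R}^2$, as $f(\theta,r)=(\Theta(\theta,r),R(\theta,r))$ with $\Theta(\theta+1,r)=\Theta(\theta,r)+1$ and $R(\theta+1,r)=R(\theta,r)$. For real numbers $\rho_-,\rho_+$, $\mathcal{P}^{\rho_+,\rho_-}$ is the class of $C^2$ diffeomorphisms $f=(\Theta,R)$ of $\mathbb{T}\times\mathbb{R}$ (given with such a lift) that: (1) are isotopic to the identity; (2) are exact symplectic, i.e. the differential form $R\,d\Theta-r\,d\theta$ is exact on $\mathbb{T}\times\mathbb{R}$; (3') are twist, i.e. $\partial\Theta/\partial r>0$; (4) preserve the ends of the cylinder, i.e. $R(\theta,r)\to\pm\infty$ as $r\to\pm\infty$ uniformly in $\theta$; (5') satisfy $\Theta(\theta,r)-\theta\to\rho_\pm$ as $r\to\pm\infty$ uniformly in $\theta$; (6) there exists $M$ such that $|R(\theta,r)-r|\leq M$ for every $(\theta,r)\in\mathbb{T}\times\mathbb{R}$. An invariant curve of $F$ is a non-contractible Jordan curve in $\mathbb{T}\times\mathbb{R}$ that is invariant under $F$. "$\Gamma_k\uparrow+\infty$ uniformly as $k\to+\infty$" means that there is a sequence $r_k\to+\infty$ as $k\to+\infty$ with $\Gamma_k\subset\mathbb{T}\times(r_k,+\infty)$; "$\Gamma_k\downarrow-\infty$ uniformly as $k\to-\infty$" means that there is a sequence $r_k\to-\infty$ as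 $k\to-\infty$ with $\Gamma_k\subset\mathbb{T}\times(-\infty,r_k)$. In the identity $F(\phi(t),\eta(t))=(\phi(t+\omega),\eta(t+\omega))$, $F$ denotes the lift to $\mathbb{R}^2$ obtained by composing the lifts of the $f_i$. "Of bounded variation" for a function on $\mathbb{R}$ means of bounded variation on every compact interval. *)

theory Defs
  imports "HOL-Analysis.Analysis"
begin

section \<open>The infinite cylinder and lifts of its self-maps\<close>

text \<open>The circle \<open>\<real>/\<int>\<close> is realised as the unit circle of the complex plane, so that the
  universal covering of the cylinder sends \<open>(\<theta>, r)\<close> to \<open>(exp (2 \<pi> \<i> \<theta>), r)\<close>.\<close>

definition cylinder :: "(complex \<times> real) set" where
  "cylinder = sphere 0 1 \<times> UNIV"

definition cyl_proj :: "real \<times> real \<Rightarrow> complex \<times> real" where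
  "cyl_proj = (\<lambda>(\<theta>, r). (cis (2 * pi * \<theta>), r))"

definition cyl_lift :: "(real \<times> real \<Rightarrow> real \<times> real) \<Rightarrow> bool" where
  "cyl_lift F \<longleftrightarrow> (\<forall>\<theta> r. F (\<theta> + 1, r) = F (\<theta>, r) + (1, 0))"

text \<open>The map of the cylinder induced by a lift. Here \<open>inv cyl_proj\<close> merely chooses some
  preimage under the covering map; for a lift the choice is irrelevant, as shown below.\<close>

definition cyl_map :: "(real \<times> real \<Rightarrow> real \<times> real) \<Rightarrow> complex \<times> real \<Rightarrow> complex \<times> real" where
  "cyl_map F = (\<lambda>z. cyl_proj (F (inv cyl_proj z)))"

lemma range_cyl_proj: "range cyl_proj = cylinder"
proof -
  have "(w, r) \<in> range cyl_proj" if "norm w = 1" for w r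
  proof -
    have "cyl_proj (Arg w / (2 * pi), r) = (w, r)"
      using that cis_Arg[of w] by (cases "w = 0") (auto simp: cyl_proj_def sgn_eq)
    then show ?thesis by (metis rangeI)
  qed
  then show ?thesis
    by (auto simp: cylinder_def cyl_proj_def)
qed

lemma cyl_lift_add_nat:
  assumes "cyl_lift F"
  shows "F (\<theta> + of_nat n, r) = F (\<theta>, r) + (of_nat n, 0)"
proof (induction n)
  case 0
  then show ?case by (simp add: zero_prod_def[symmetric])
next
  case (Suc n)
  have "F ((\<theta> + of_nat n) + 1, r) = F (\<theta> + of_nat n, r) + (1, 0)"
    using assms unfolding cyl_lift_def by blast
  with Suc show ?case by (simp add: algebra_simps)
qed

lemma cyl_lift_add_int:
  assumes "cyl_lift F"
  shows "F (\<theta> + of_int m, r) = F (\<theta>, r) + (of_int m, 0)"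
proof (cases m)
  case (nonneg n)
  then show ?thesis using cyl_lift_add_nat[OF assms] by simp
next
  case (neg n)
  have "F ((\<theta> + of_int m) + of_nat (Suc n), r) = F (\<theta> + of_int m, r) + (of_nat (Suc n), 0)"
    by (rule cyl_lift_add_nat[OF assms])
  with neg show ?thesis by (simp add: prod_eq_iff)
qed

lemma cyl_map_cyl_proj:
  assumes "cyl_lift F"
  shows "cyl_map F (cyl_proj x) = cyl_proj (F x)"
proof -
  obtain \<theta> r where x: "x = (\<theta>, r)" by (cases x)
  obtain \<theta>' r' where y: "inv cyl_proj (cyl_proj x) = (\<theta>', r')" by fastforce
  have "cyl_proj (\<theta>', r') = cyl_proj (\<theta>, r)"
    by (metis f_inv_into_f rangeI x y)
  then have r: "r' = r" and "cis (2 * pi * \<theta>') = cis (2 * pi * \<theta>)"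
    by (auto simp: cyl_proj_def)
  then have "sin (2 * pi * \<theta>') = sin (2 * pi * \<theta>) \<and> cos (2 * pi * \<theta>') = cos (2 * pi * \<theta>)"
    by (simp add: complex_eq_iff)
  then obtain m :: int where "2 * pi * \<theta>' = 2 * pi * \<theta> + 2 * pi * of_int m"
    using sin_cos_eq_iff by metis
  then have "2 * pi * \<theta>' = 2 * pi * (\<theta> + of_int m)"
    by (simp add: algebra_simps)
  then have "\<theta>' = \<theta> + of_int m" by simp
  then have "F (\<theta>', r') = F (\<theta>, r) + (of_int m, 0)"
    using cyl_lift_add_int[OF assms] r by simp
  moreover have "cis (2 * pi * (a + of_int m)) = cis (2 * pi * a)" for a
    by (simp add: distrib_left cis_mult[symmetric] cis_multiple_2pi)
  ultimately have "cyl_proj (F (\<theta>', r')) = cyl_proj (F (\<theta>, r))"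
    by (simp add: cyl_proj_def split_beta)
  with x y show ?thesis
    by (simp add: cyl_map_def)
qed


section \<open>The class of maps\<close>

definition C1 :: "('a::real_normed_vector \<Rightarrow> 'b::real_normed_vector) \<Rightarrow> bool" where
  "C1 f \<longleftrightarrow> (\<exists>f' :: 'a \<Rightarrow> 'a \<Rightarrow>\<^sub>L 'b.
     (\<forall>x. (f has_derivative blinfun_apply (f' x)) (at x)) \<and> continuous_on UNIV f')"

definition C2 :: "('a::real_normed_vector \<Rightarrow> 'b::real_normed_vector) \<Rightarrow> bool" where
  "C2 f \<longleftrightarrow> (\<exists>f' :: 'a \<Rightarrow> 'a \<Rightarrow>\<^sub>L 'b.
     (\<forall>x. (f has_derivative blinfun_apply (f' x)) (at x)) \<and> C1 f')"

text \<open>Since the covering map is a local diffeomorphism, a lift induces a \<open>C\<^sup>2\<close> diffeomorphism of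
  the cylinder iff it is itself a \<open>C\<^sup>2\<close> diffeomorphism of the plane.\<close>

definition C2_diffeo :: "(real \<times> real \<Rightarrow> real \<times> real) \<Rightarrow> bool" where
  "C2_diffeo F \<longleftrightarrow> bij F \<and> C2 F \<and> C2 (inv F)"

definition isotopic_to_id :: "(complex \<times> real \<Rightarrow> complex \<times> real) \<Rightarrow> bool" where
  "isotopic_to_id f \<longleftrightarrow>
     homotopic_with_canon (\<lambda>h. \<exists>g. homeomorphism cylinder cylinder h g) cylinder cylinder id f"

text \<open>With \<open>F = (\<Theta>, R)\<close>, the 1-form \<open>R d\<Theta> - r d\<theta>\<close> takes at \<open>(\<theta>, r)\<close> and on the tangent vector
  \<open>v\<close> the value \<open>R(\<theta>, r) \<cdot> fst (DF v) - r \<cdot> fst v\<close>. It must be the differential of a function on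
  the cylinder, that is, of a 1-periodic function of \<open>\<theta>\<close>.\<close>

definition exact_symplectic :: "(real \<times> real \<Rightarrow> real \<times> real) \<Rightarrow> bool" where
  "exact_symplectic F \<longleftrightarrow> (\<exists>S :: real \<times> real \<Rightarrow> real.
     (\<forall>\<theta> r. S (\<theta> + 1, r) = S (\<theta>, r)) \<and>
     (\<forall>x. (S has_derivative
        (\<lambda>v. snd (F x) * fst (frechet_derivative F (at x) v) - snd x * fst v)) (at x)))"

definition twist :: "(real \<times> real \<Rightarrow> real \<times> real) \<Rightarrow> bool" where
  "twist F \<longleftrightarrow> (\<forall>\<theta> r. deriv (\<lambda>s. fst (F (\<theta>, s))) r > 0)"

definition preserves_ends :: "(real \<times> real \<Rightarrow> real \<times> real) \<Rightarrow> bool" where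
  "preserves_ends F \<longleftrightarrow>
     (\<forall>K. \<forall>\<^sub>F r in at_top. \<forall>\<theta>. snd (F (\<theta>, r)) > K) \<and>
     (\<forall>K. \<forall>\<^sub>F r in at_bot. \<forall>\<theta>. snd (F (\<theta>, r)) < K)"

definition class_P :: "real \<Rightarrow> real \<Rightarrow> (real \<times> real \<Rightarrow> real \<times> real) set" where
  "class_P \<rho>p \<rho>m = {F. cyl_lift F \<and> C2_diffeo F \<and>
     isotopic_to_id (cyl_map F) \<and>
     exact_symplectic F \<and>
     twist F \<and>
     preserves_ends F \<and>
     uniform_limit UNIV (\<lambda>r \<theta>. fst (F (\<theta>, r)) - \<theta>) (\<lambda>_. \<rho>p) at_top \<and>
     uniform_limit UNIV (\<lambda>r \<theta>. fst (F (\<theta>, r)) - \<theta>) (\<lambda>_. \<rho>m) at_bot \<and>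
     (\<exists>M. \<forall>\<theta> r. \<bar>snd (F (\<theta>, r)) - r\<bar> \<le> M)}"


section \<open>Invariant curves and bounded variation\<close>

definition noncontractible_jordan_curve :: "(complex \<times> real) set \<Rightarrow> bool" where
  "noncontractible_jordan_curve \<Gamma> \<longleftrightarrow> (\<exists>g :: real \<Rightarrow> complex \<times> real.
     simple_path g \<and> pathfinish g = pathstart g \<and> path_image g = \<Gamma> \<and> \<Gamma> \<subseteq> cylinder \<and>
     \<not> (\<exists>a. homotopic_loops cylinder g (linepath a a)))"

definition invariant_curve ::
    "(complex \<times> real \<Rightarrow> complex \<times> real) \<Rightarrow> (complex \<times> real) set \<Rightarrow> bool" where
  "invariant_curve f \<Gamma> \<longleftrightarrow> noncontractible_jordan_curve \<Gamma> \<and> f ` \<Gamma> = \<Gamma>"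

definition curves_to_top :: "(int \<Rightarrow> (complex \<times> real) set) \<Rightarrow> bool" where
  "curves_to_top \<Gamma> \<longleftrightarrow> (\<exists>r :: int \<Rightarrow> real. filterlim r at_top at_top \<and>
     (\<forall>k. \<Gamma> k \<subseteq> sphere 0 1 \<times> {r k<..}))"

definition curves_to_bot :: "(int \<Rightarrow> (complex \<times> real) set) \<Rightarrow> bool" where
  "curves_to_bot \<Gamma> \<longleftrightarrow> (\<exists>r :: int \<Rightarrow> real. filterlim r at_bot at_bot \<and>
     (\<forall>k. \<Gamma> k \<subseteq> sphere 0 1 \<times> {..<r k}))"

definition bounded_variation_on :: "real \<Rightarrow> real \<Rightarrow> (real \<Rightarrow> real) \<Rightarrow> bool" where
  "bounded_variation_on a b f \<longleftrightarrow> (\<exists>C. \<forall>(n::nat) t.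
     (\<forall>i\<le>n. t i \<in> {a..b}) \<and> (\<forall>i<n. t i \<le> t (Suc i)) \<longrightarrow>
     (\<Sum>i<n. \<bar>f (t (Suc i)) - f (t i)\<bar>) \<le> C)"

definition locally_bounded_variation :: "(real \<Rightarrow> real) \<Rightarrow> bool" where
  "locally_bounded_variation f \<longleftrightarrow> (\<forall>a b. bounded_variation_on a b f)"

end

theory Submission
  imports Defs
begin

text \<open>The orbits are found variationally. Fix a map \<open>f = (\<Theta>, R)\<close> of the class. By the twist condition,
over \<open>x\<close> there is a point sent over \<open>y\<close> iff \<open>\<rho>m < y - x < \<rho>p\<close>, and then it is unique; write
\<open>r\<close> for its height and \<open>R\<close> for the height of its image. Exactness provides a generating function
\<open>h\<close> on this strip with \<open>dh = R dy - r dx\<close>, invariant under \<open>(x, y) \<mapsto> (x + 1, y + 1)\<close>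
(\<open>has_derivative_gen\<close>, \<open>gen_shift\<close>). Orbits of the composition are orbits of an
\<open>N\<close>-periodic chain of maps \<open>g n\<close>, and these are the sequences of angles at which the formal sum
of all \<open>h\<^sub>n (x n, x (n + 1))\<close> is stationary.

For rational \<open>\<omega>\<close> one minimises this sum over a period among periodic sequences of mean step
\<open>\<omega> / N\<close>. The domain is not closed, so the steps are first confined to
\<open>[\<rho>m + \<epsilon>, \<rho>p - \<epsilon>]\<close>. If a minimiser touched this wall, one point of it would have a huge
height; moving single sites shows that the heights of its successors drop by at most the bound \<open>M\<close>
on \<open>\<bar>R - r\<bar>\<close> at each step, so all steps of a period would be close to \<open>\<rho>p\<close> (or \<open>\<rho>m\<close>),
against their mean (\<open>minims_below_upper_wall\<close>). Minimisers are therefore orbits. The twist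
condition makes \<open>h\<close> strictly submodular (\<open>gen_crossing\<close>), whence the minimum and the maximum of two
minimisers are again minimisers and two minimisers never cross (\<open>minims_ordered\<close>). Applied to a
minimiser and its translates this is the Birkhoff property: the points \<open>x (n + a N) + b\<close> are ordered
like the numbers \<open>a \<omega> + b\<close>.

A Birkhoff orbit deviates from the rigid rotation by at most one. Hence it cannot stay high for long,
because high points advance by almost \<open>\<rho>p\<close>; and it cannot come down fast, because heights change
by at most \<open>M\<close>. This confines all Birkhoff orbits, with a bound locally uniform in \<open>\<omega>\<close>
(\<open>birkhoff_bounded\<close>), so that irrational rotation numbers are reached as limits
(\<open>exists_birkhoff\<close>).

Finally, \<open>\<phi> t\<close> is the supremum of the numbers \<open>x (a N) + b\<close> with \<open>a \<omega> + b \<le> t\<close>, and \<open>\<eta> t\<close> is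
the height of the corresponding limit of translated orbits (\<open>orbit_on_hull\<close>). The conjugacy equation
only expresses that the family of translates is invariant under translation. Strict monotonicity holds
because ordered orbits that touch coincide (\<open>ordered_orbits_touch\<close>), and \<open>\<eta>\<close> has bounded
variation because, at bounded heights, the height is a Lipschitz function of two consecutive angles,
both of which are monotone in \<open>t\<close> (\<open>radius_lipschitz\<close>).\<close>

section \<open>Twist maps and their generating functions\<close>

locale twist_map =
  fixes f :: "real \<times> real \<Rightarrow> real \<times> real" and \<rho>p \<rho>m :: real
  assumes in_class: "f \<in> class_P \<rho>p \<rho>m"
begin

lemma derivative_of_angle:
  obtains tx tr :: "real \<times> real \<Rightarrow> real" where
    "\<And>z. (f has_derivative frechet_derivative f (at z)) (at z)"
    "\<And>z v. fst (frechet_derivative f (at z) v) = tx z * fst v + tr z * snd v"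
    "\<And>x r. ((\<lambda>s. fst (f (s, r))) has_field_derivative tx (x, r)) (at x)"
    "\<And>x r. ((\<lambda>s. fst (f (x, s))) has_field_derivative tr (x, r)) (at r)"
    "continuous_on UNIV tx" "continuous_on UNIV tr" "\<And>z. 0 < tr z"
proof -
  from in_class have "C2 f" by (simp add: class_P_def C2_diffeo_def)
  then obtain f' :: "real \<times> real \<Rightarrow> (real \<times> real) \<Rightarrow>\<^sub>L (real \<times> real)"
    where f': "\<And>z. (f has_derivative blinfun_apply (f' z)) (at z)" and "C1 f'"
    by (auto simp: C2_def)
  then have cont: "continuous_on UNIV f'"
    unfolding C1_def by (metis continuous_at_imp_continuous_on has_derivative_continuous)
  have fr: "frechet_derivative f (at z) = blinfun_apply (f' z)" for z
    using frechet_derivative_at[OF f'] by simp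
  define tx where "tx z = fst (f' z (1, 0))" for z
  define tr where "tr z = fst (f' z (0, 1))" for z
  have lin: "fst (f' z v) = tx z * fst v + tr z * snd v" for z v
  proof -
    have "v = fst v *\<^sub>R (1, 0) + snd v *\<^sub>R (0, 1)" by (cases v) simp
    then have "f' z v = fst v *\<^sub>R f' z (1, 0) + snd v *\<^sub>R f' z (0, 1)"
      by (metis blinfun.add_right blinfun.scaleR_right)
    then show ?thesis by (simp add: tx_def tr_def)
  qed
  have dx: "((\<lambda>s. fst (f (s, r))) has_field_derivative tx (x, r)) (at x)" for x r
  proof -
    have "((\<lambda>s. fst (f (s, r))) has_derivative (\<lambda>s. fst (f' (x, r) (s, 0)))) (at x)"
      by (rule has_derivative_fst, rule has_derivative_compose[where g = f, OF _ f'])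
         (auto intro!: derivative_eq_intros)
    then show ?thesis by (simp add: lin has_field_derivative_def)
  qed
  have dr: "((\<lambda>s. fst (f (x, s))) has_field_derivative tr (x, r)) (at r)" for x r
  proof -
    have "((\<lambda>s. fst (f (x, s))) has_derivative (\<lambda>s. fst (f' (x, r) (0, s)))) (at r)"
      by (rule has_derivative_fst, rule has_derivative_compose[where g = f, OF _ f'])
         (auto intro!: derivative_eq_intros)
    then show ?thesis by (simp add: lin has_field_derivative_def)
  qed
  have "twist f" using in_class by (simp add: class_P_def)
  then have "0 < tr (x, r)" for x r
    using DERIV_imp_deriv[OF dr] unfolding twist_def by metis
  then have "0 < tr z" for z by (cases z) simp
  moreover have "continuous_on UNIV tx" "continuous_on UNIV tr"
    unfolding tx_def tr_def using cont by (auto intro!: continuous_intros)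
  ultimately show thesis
    using that[of tx tr] f' lin fr dx dr by simp
qed

lemma continuous_map: "continuous_on UNIV f"
  by (rule derivative_of_angle) (metis continuous_at_imp_continuous_on has_derivative_continuous)

lemma continuous_angle: "continuous_on UNIV (\<lambda>x. fst (f (x, g x)))" if "continuous_on UNIV g" for g
  using that by (intro continuous_on_fst continuous_on_compose2[OF continuous_map] continuous_intros) auto

lemma bij: "bij f"
  using in_class by (simp add: class_P_def C2_diffeo_def)

lemma continuous_inv: "continuous_on UNIV (inv f)"
proof -
  from in_class have "C2 (inv f)" by (simp add: class_P_def C2_diffeo_def)
  then show ?thesis
    unfolding C2_def by (metis continuous_at_imp_continuous_on has_derivative_continuous)
qed

lemma lift: "f (x + of_int b, r) = f (x, r) + (of_int b, 0)"
  using in_class by (intro cyl_lift_add_int) (simp add: class_P_def)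

lemma radius_displacement_bounded: "\<exists>M. \<forall>z. \<bar>snd (f z) - snd z\<bar> \<le> M"
  using in_class by (auto simp: class_P_def)

lemma angle_strict_mono: "fst (f (x, r)) < fst (f (x, s))" if "r < s"
  by (rule derivative_of_angle) (use that DERIV_pos_imp_increasing in metis)

lemma angle_less_iff: "fst (f (x, r)) < fst (f (x, s)) \<longleftrightarrow> r < s"
  using angle_strict_mono by (metis linorder_neqE not_less_iff_gr_or_eq)

lemma angle_eq_iff: "fst (f (x, r)) = fst (f (x, s)) \<longleftrightarrow> r = s"
  using angle_less_iff by (metis linorder_neq_iff)

lemma step_tendsto_top: "0 < \<delta> \<Longrightarrow> \<exists>C. \<forall>x r. C \<le> r \<longrightarrow> \<rho>p - \<delta> < fst (f (x, r)) - x"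
proof -
  assume "0 < \<delta>"
  from in_class have "uniform_limit UNIV (\<lambda>r \<theta>. fst (f (\<theta>, r)) - \<theta>) (\<lambda>_. \<rho>p) at_top"
    by (simp add: class_P_def)
  from uniform_limitD[OF this \<open>0 < \<delta>\<close>] show ?thesis
    unfolding eventually_at_top_linorder dist_real_def
  proof (elim exE, intro exI allI impI)
    fix C x r assume "\<forall>r\<ge>C. \<forall>x\<in>UNIV. \<bar>fst (f (x, r)) - x - \<rho>p\<bar> < \<delta>" "C \<le> r"
    then have "\<bar>fst (f (x, r)) - x - \<rho>p\<bar> < \<delta>" by blast
    then show "\<rho>p - \<delta> < fst (f (x, r)) - x" by linarith
  qed
qed

lemma step_tendsto_bot: "0 < \<delta> \<Longrightarrow> \<exists>C. \<forall>x r. r \<le> C \<longrightarrow> fst (f (x, r)) - x < \<rho>m + \<delta>"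
proof -
  assume "0 < \<delta>"
  from in_class have "uniform_limit UNIV (\<lambda>r \<theta>. fst (f (\<theta>, r)) - \<theta>) (\<lambda>_. \<rho>m) at_bot"
    by (simp add: class_P_def)
  from uniform_limitD[OF this \<open>0 < \<delta>\<close>] show ?thesis
    unfolding eventually_at_bot_linorder dist_real_def
  proof (elim exE, intro exI allI impI)
    fix C x r assume "\<forall>r\<le>C. \<forall>x\<in>UNIV. \<bar>fst (f (x, r)) - x - \<rho>m\<bar> < \<delta>" "r \<le> C"
    then have "\<bar>fst (f (x, r)) - x - \<rho>m\<bar> < \<delta>" by blast
    then show "fst (f (x, r)) - x < \<rho>m + \<delta>" by linarith
  qed
qed

lemma step_limits:
  "((\<lambda>r. fst (f (x, r)) - x) \<longlongrightarrow> \<rho>p) at_top" "((\<lambda>r. fst (f (x, r)) - x) \<longlongrightarrow> \<rho>m) at_bot"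
  using in_class by (auto simp: class_P_def dest!: tendsto_uniform_limitI[where x = x])

lemma step_less: "fst (f (x, r)) - x < \<rho>p"
proof -
  have "eventually (\<lambda>s. fst (f (x, r + 1)) - x \<le> fst (f (x, s)) - x) at_top"
    using eventually_ge_at_top[of "r + 1"]
    by eventually_elim (simp add: angle_less_iff not_less[symmetric])
  then have "fst (f (x, r + 1)) - x \<le> \<rho>p"
    by (rule tendsto_lowerbound[OF step_limits(1)]) simp
  then show ?thesis using angle_strict_mono[of r "r + 1" x] by simp
qed

lemma step_greater: "\<rho>m < fst (f (x, r)) - x"
proof -
  have "eventually (\<lambda>s. fst (f (x, s)) - x \<le> fst (f (x, r - 1)) - x) at_bot"
    using eventually_le_at_bot[of "r - 1"]
    by eventually_elim (simp add: angle_less_iff not_less[symmetric])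
  then have "\<rho>m \<le> fst (f (x, r - 1)) - x"
    by (rule tendsto_upperbound[OF step_limits(2)]) simp
  then show ?thesis using angle_strict_mono[of "r - 1" r x] by simp
qed

lemma angle_surj:
  assumes "\<rho>m < y - x" "y - x < \<rho>p"
  shows "\<exists>r. fst (f (x, r)) = y"
proof -
  obtain a where a: "\<rho>p - (\<rho>p - (y - x)) < fst (f (x, a)) - x"
    using step_tendsto_top[of "\<rho>p - (y - x)"] assms
    by (metis diff_gt_0_iff_gt order_refl)
  obtain b where b: "fst (f (x, b)) - x < \<rho>m + (y - x - \<rho>m)"
    using step_tendsto_bot[of "y - x - \<rho>m"] assms
    by (metis diff_gt_0_iff_gt order_refl)
  from a b have "b \<le> a" using angle_less_iff[of x b a] by linarith
  moreover have "continuous_on {b..a} (\<lambda>r. fst (f (x, r)))"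
    by (intro continuous_on_fst continuous_on_compose2[OF continuous_map] continuous_intros) auto
  ultimately show ?thesis using IVT'[of "\<lambda>r. fst (f (x, r))" b y a] a b by force
qed

text \<open>The pairs \<open>(x, y)\<close> such that some point over \<open>x\<close> is sent over \<open>y\<close>, by the intermediate value
theorem.\<close>

definition strip :: "(real \<times> real) set" where
  "strip = {(x, y). \<rho>m < y - x \<and> y - x < \<rho>p}"

definition radius :: "real \<Rightarrow> real \<Rightarrow> real" where
  "radius x y = (THE r. fst (f (x, r)) = y)"

definition image_radius :: "real \<Rightarrow> real \<Rightarrow> real" where
  "image_radius x y = snd (f (x, radius x y))"

lemma strip_iff: "(x, y) \<in> strip \<longleftrightarrow> \<rho>m < y - x \<and> y - x < \<rho>p"
  by (simp add: strip_def)

lemma radius_unique [simp]: "radius x (fst (f (x, r))) = r"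
  unfolding radius_def by (simp add: angle_eq_iff)

lemma angle_in_strip: "(x, fst (f (x, r))) \<in> strip"
  by (simp add: strip_iff step_less step_greater)

lemma angle_radius: "(x, y) \<in> strip \<Longrightarrow> fst (f (x, radius x y)) = y"
  using angle_surj[of y x] radius_unique by (metis strip_iff)

lemma map_radius: "(x, y) \<in> strip \<Longrightarrow> f (x, radius x y) = (y, image_radius x y)"
  by (simp add: image_radius_def angle_radius prod_eq_iff)

lemma radius_less:
  "(x, y) \<in> strip \<Longrightarrow> (x, y') \<in> strip \<Longrightarrow> y < y' \<Longrightarrow> radius x y < radius x y'"
  using angle_less_iff[of x "radius x y" "radius x y'"] by (simp add: angle_radius)

lemma radius_shift:
  assumes "(x, y) \<in> strip"
  shows "radius (x + of_int b) (y + of_int b) = radius x y"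
  using radius_unique[of "x + of_int b" "radius x y"] by (simp add: lift angle_radius assms)

text \<open>The step \<open>\<Theta> - \<theta>\<close> is periodic in \<open>\<theta>\<close>, so at a fixed height \<open>L\<close> it attains its extrema, and
these lie strictly between \<open>\<rho>m\<close> and \<open>\<rho>p\<close>. By monotonicity in \<open>r\<close>, a step beyond the extremum
forces a height beyond \<open>L\<close>: the two lemmas that follow.\<close>

lemma step_bounded_away:
  "\<exists>\<epsilon>>0. \<forall>x. fst (f (x, L)) - x < \<rho>p - \<epsilon> \<and> \<rho>m + \<epsilon> < fst (f (x, L)) - x"
proof -
  let ?s = "\<lambda>x. fst (f (x, L)) - x"
  have cont: "continuous_on {0..1} ?s"
    by (rule continuous_on_subset[of UNIV]) (auto intro!: continuous_intros continuous_angle)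
  obtain u where u: "\<And>x. x \<in> {0..1} \<Longrightarrow> ?s x \<le> ?s u"
    using continuous_attains_sup[OF _ _ cont] by (metis atLeastAtMost_iff compact_Icc empty_iff order_refl zero_le_one)
  obtain l where l: "\<And>x. x \<in> {0..1} \<Longrightarrow> ?s l \<le> ?s x"
    using continuous_attains_inf[OF _ _ cont] by (metis atLeastAtMost_iff compact_Icc empty_iff order_refl zero_le_one)
  have per: "\<exists>x'\<in>{0..1}. ?s x = ?s x'" for x
  proof (rule bexI)
    show "?s x = ?s (frac x)"
      using lift[of "frac x" "\<lfloor>x\<rfloor>" L] by (simp add: frac_def)
  qed (simp add: frac_ge_0 frac_lt_1 less_imp_le)
  define \<epsilon> where "\<epsilon> = min (\<rho>p - ?s u) (?s l - \<rho>m) / 2"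
  have "0 < \<epsilon>" using step_less[of u L] step_greater[of l L] by (simp add: \<epsilon>_def)
  moreover have "?s x < \<rho>p - \<epsilon> \<and> \<rho>m + \<epsilon> < ?s x" for x
  proof -
    obtain x' where "x' \<in> {0..1}" "?s x = ?s x'" using per by blast
    then have "?s l \<le> ?s x" "?s x \<le> ?s u" using u l by auto
    moreover have "\<epsilon> < \<rho>p - ?s u" "\<epsilon> < ?s l - \<rho>m"
      using step_less[of u L] step_greater[of l L] by (auto simp: \<epsilon>_def min_def field_simps)
    ultimately show ?thesis by linarith
  qed
  ultimately show ?thesis by blast
qed

lemma radius_large:
  "\<exists>\<epsilon>>0. \<forall>x y. (x, y) \<in> strip \<longrightarrow> \<rho>p - \<epsilon> \<le> y - x \<longrightarrow> L \<le> radius x y"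
proof -
  obtain \<epsilon> where "0 < \<epsilon>" and e: "\<And>x. fst (f (x, L)) - x < \<rho>p - \<epsilon>"
    using step_bounded_away by blast
  have "L \<le> radius x y" if "(x, y) \<in> strip" "\<rho>p - \<epsilon> \<le> y - x" for x y
    using angle_less_iff[of x L "radius x y"] angle_radius[OF that(1)] e[of x] that(2) by simp
  with \<open>0 < \<epsilon>\<close> show ?thesis by blast
qed

lemma radius_small:
  "\<exists>\<epsilon>>0. \<forall>x y. (x, y) \<in> strip \<longrightarrow> y - x \<le> \<rho>m + \<epsilon> \<longrightarrow> radius x y \<le> L"
proof -
  obtain \<epsilon> where "0 < \<epsilon>" and e: "\<And>x. \<rho>m + \<epsilon> < fst (f (x, L)) - x"
    using step_bounded_away by blast
  have "radius x y \<le> L" if "(x, y) \<in> strip" "y - x \<le> \<rho>m + \<epsilon>" for x y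
    using angle_less_iff[of x "radius x y" L] angle_radius[OF that(1)] e[of x] that(2) by simp
  with \<open>0 < \<epsilon>\<close> show ?thesis by blast
qed

text \<open>A potential of \<open>R d\<Theta> - r d\<theta>\<close>. Its periodicity, which is exactness on the cylinder and not just
closedness, is what makes the action below invariant under integer translations.\<close>

definition primitive :: "real \<times> real \<Rightarrow> real" where
  "primitive = (SOME S. (\<forall>\<theta> r. S (\<theta> + 1, r) = S (\<theta>, r)) \<and>
     (\<forall>x. (S has_derivative
        (\<lambda>v. snd (f x) * fst (frechet_derivative f (at x) v) - snd x * fst v)) (at x)))"

lemma primitive:
  "primitive (\<theta> + 1, r) = primitive (\<theta>, r)"
  "(primitive has_derivative
        (\<lambda>v. snd (f z) * fst (frechet_derivative f (at z) v) - snd z * fst v)) (at z)"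
proof -
  from in_class have "exact_symplectic f" by (simp add: class_P_def)
  from someI_ex[OF this[unfolded exact_symplectic_def], folded primitive_def]
  show "primitive (\<theta> + 1, r) = primitive (\<theta>, r)"
  "(primitive has_derivative
        (\<lambda>v. snd (f z) * fst (frechet_derivative f (at z) v) - snd z * fst v)) (at z)" by blast+
qed

text \<open>The generating function is this potential expressed in the coordinates \<open>(x, y) = (x, \<Theta>(x, r))\<close>.\<close>

definition gen :: "real \<times> real \<Rightarrow> real" where
  "gen = (\<lambda>(x, y). primitive (x, radius x y))"

lemma primitive_shift: "primitive (x + of_int b, r) = primitive (x, r)"
proof (induction b rule: int_induct[where k = 0])
  case (step1 i)
  then show ?case using primitive(1)[of "x + of_int i" r] by (simp add: add.assoc)
next
  case (step2 i)
  then show ?case using primitive(1)[of "x + of_int (i - 1)" r] by simp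
qed simp

lemma gen_shift: "(x, y) \<in> strip \<Longrightarrow> gen (x + of_int b, y + of_int b) = gen (x, y)"
  by (simp add: gen_def radius_shift primitive_shift)

text \<open>The change of coordinates \<open>(x, r) \<mapsto> (x, \<Theta>(x, r))\<close> has an invertible derivative since
\<open>\<partial>\<Theta>/\<partial>r > 0\<close>, so its inverse is differentiable, and in the new coordinates \<open>d\<Theta>\<close> is just
\<open>dy\<close>.\<close>

lemma has_derivative_gen:
  assumes "(x, y) \<in> strip"
  shows "(gen has_derivative (\<lambda>v. image_radius x y * snd v - radius x y * fst v)) (at (x, y))"
proof -
  obtain tx tr where a: "\<And>z. (f has_derivative frechet_derivative f (at z)) (at z)"
    "\<And>z v. fst (frechet_derivative f (at z) v) = tx z * fst v + tr z * snd v"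
    "\<And>z. 0 < tr z" by (rule derivative_of_angle) blast
  define G where "G = (\<lambda>z. (fst z, fst (f z)))"
  define H where "H = (\<lambda>(x, y). (x, radius x y))"
  define z where "z = (x, radius x y)"
  define H' where "H' = (\<lambda>v :: real \<times> real. (fst v, (snd v - tx z * fst v) / tr z))"
  have G': "(G has_derivative (\<lambda>v. (fst v, tx z * fst v + tr z * snd v))) (at z)" (is "(_ has_derivative ?G') _")
    unfolding G_def a(2)[symmetric]
    by (intro has_derivative_Pair has_derivative_fst has_derivative_ident a(1))
  have contG: "continuous_on UNIV G"
    unfolding G_def by (intro continuous_intros continuous_on_fst continuous_map)
  have Gz: "G z = (x, y)" by (simp add: G_def z_def angle_radius assms)
  have HG: "H (G w) = w" for w
    by (cases w) (simp add: G_def H_def)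
  have id: "?G' \<circ> H' = id"
    using a(3)[of z] by (auto simp: H'_def fun_eq_iff)
  have H: "(H has_derivative H') (at (x, y))"
    using has_derivative_inverse_strong[OF open_UNIV _ contG HG G' id] by (simp add: Gz)
  have gen: "gen = (\<lambda>w. primitive (H w))" by (auto simp: gen_def H_def fun_eq_iff)
  have Hxy: "H (x, y) = z" by (simp add: H_def z_def)
  have "(gen has_derivative (\<lambda>v. snd (f z) * fst (frechet_derivative f (at z) (H' v)) - snd z * fst (H' v))) (at (x, y))"
    unfolding gen by (rule has_derivative_compose[OF H]) (simp add: Hxy primitive(2))
  moreover have "snd (f z) = image_radius x y" "snd z = radius x y"
    by (simp_all add: image_radius_def z_def)
  moreover have "fst (frechet_derivative f (at z) (H' v)) = snd v" "fst (H' v) = fst v" for v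
    using a(3)[of z] by (simp_all add: a(2) H'_def)
  ultimately show ?thesis by simp
qed

lemma continuous_gen: "continuous_on strip gen"
  using has_derivative_gen by (intro continuous_at_imp_continuous_on) (auto intro: has_derivative_continuous)

lemma gen_partial1:
  assumes "(x, y) \<in> strip"
  shows "((\<lambda>x. gen (x, y)) has_field_derivative - radius x y) (at x)"
proof -
  have "((\<lambda>x. gen (x, y)) has_derivative (\<lambda>v. image_radius x y * snd (v, 0::real) - radius x y * fst (v, 0::real))) (at x)"
    by (rule has_derivative_compose[where g = gen]) (auto intro!: derivative_eq_intros has_derivative_gen[OF assms, simplified])
  then show ?thesis unfolding has_field_derivative_def by (rule has_derivative_eq_rhs) (simp add: fun_eq_iff)
qed

lemma gen_partial2:
  assumes "(x, y) \<in> strip"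
  shows "((\<lambda>y. gen (x, y)) has_field_derivative image_radius x y) (at y)"
proof -
  have "((\<lambda>y. gen (x, y)) has_derivative (\<lambda>v. image_radius x y * snd (0::real, v) - radius x y * fst (0::real, v))) (at y)"
    by (rule has_derivative_compose[where g = gen]) (auto intro!: derivative_eq_intros has_derivative_gen[OF assms, simplified])
  then show ?thesis by (simp add: has_field_derivative_def)
qed

text \<open>This is the variational form of the twist condition: the \<open>x\<close>-derivative of
\<open>gen (x, y') - gen (x, y)\<close> is \<open>radius x y - radius x y'\<close>, which is negative. The strip is
such that uncrossing two pairs never leaves it.\<close>

lemma gen_crossing:
  assumes "x < x'" "y < y'" "(x, y') \<in> strip" "(x', y) \<in> strip"
  shows "gen (x, y) + gen (x', y') < gen (x, y') + gen (x', y)"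
proof -
  have "gen (x', y') - gen (x', y) < gen (x, y') - gen (x, y)"
  proof (rule DERIV_neg_imp_decreasing[OF assms(1)])
    fix s assume s: "x \<le> s" "s \<le> x'"
    then have st: "(s, y) \<in> strip" "(s, y') \<in> strip" using assms by (auto simp: strip_iff)
    have "((\<lambda>s. gen (s, y') - gen (s, y)) has_field_derivative - radius s y' - - radius s y) (at s)"
      by (intro DERIV_diff gen_partial1 st)
    moreover have "- radius s y' - - radius s y < 0" using radius_less[OF st assms(2)] by simp
    ultimately show "\<exists>d. ((\<lambda>s. gen (s, y') - gen (s, y)) has_field_derivative d) (at s) \<and> d < 0"
      by blast
  qed
  then show ?thesis by simp
qed

lemma gen_min_max_less:
  assumes "x < y" "y' < x'" "(x, x') \<in> strip" "(y, y') \<in> strip"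
  shows "gen (min x y, min x' y') + gen (max x y, max x' y') < gen (x, x') + gen (y, y')"
  using gen_crossing[of x y y' x'] assms by (simp add: min_def max_def)

lemma gen_min_max_le:
  assumes "(x, x') \<in> strip" "(y, y') \<in> strip"
  shows "gen (min x y, min x' y') + gen (max x y, max x' y') \<le> gen (x, x') + gen (y, y')"
proof -
  consider "x < y" "y' < x'" | "y < x" "x' < y'" | "x \<le> y" "x' \<le> y'" | "y \<le> x" "y' \<le> x'"
    by linarith
  then show ?thesis
  proof cases
    case 1
    then show ?thesis using gen_min_max_less[of x y y' x'] assms by simp
  next
    case 2
    then show ?thesis using gen_min_max_less[of y x x' y'] assms by (simp add: min.commute max.commute)
  qed (simp_all add: min_def max_def)
qed

text \<open>Formally \<open>\<partial>R/\<partial>x = \<partial>\<^sup>2h/\<partial>x\<partial>y = - \<partial>r/\<partial>y < 0\<close>. The sign is read off from the crossing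
inequality, which avoids a second derivative of the generating function.\<close>

lemma image_radius_antimono:
  assumes "x \<le> x'" "(x, y) \<in> strip" "(x', y) \<in> strip"
  shows "image_radius x' y \<le> image_radius x y"
proof (rule ccontr)
  assume "\<not> ?thesis"
  then have pos: "0 < image_radius x' y - image_radius x y" by simp
  then have "x < x'" using assms(1) by (cases "x = x'") auto
  have "((\<lambda>y. gen (x', y) - gen (x, y)) has_field_derivative image_radius x' y - image_radius x y) (at y)"
    by (intro DERIV_diff gen_partial2 assms)
  from DERIV_pos_inc_right[OF this pos] obtain d where d: "0 < d"
    "\<And>h. 0 < h \<Longrightarrow> h < d \<Longrightarrow> gen (x', y) - gen (x, y) < gen (x', y + h) - gen (x, y + h)" by auto
  define h where "h = min d (\<rho>p - (y - x)) / 2"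
  have h: "0 < h" "h < d" "h < \<rho>p - (y - x)"
    using d(1) assms(2) by (auto simp: h_def strip_iff min_def)
  have "gen (x, y) + gen (x', y + h) < gen (x, y + h) + gen (x', y)"
    using h assms \<open>x < x'\<close> by (intro gen_crossing) (auto simp: strip_iff)
  with d(2)[OF h(1,2)] show False by simp
qed

lemma frechet_derivative_shift:
  "frechet_derivative f (at (x + of_int b, r)) = frechet_derivative f (at (x, r))"
proof -
  obtain tx tr where a: "\<And>z. (f has_derivative frechet_derivative f (at z)) (at z)"
    by (rule derivative_of_angle) blast
  have "((\<lambda>w. f (w + (of_int b, 0))) has_derivative frechet_derivative f (at (x + of_int b, r))) (at (x, r))"
    by (rule has_derivative_compose[of "\<lambda>w. w + (of_int b, 0)" "\<lambda>v. v" "(x, r)" UNIV f])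
       (use a[of "(x + of_int b, r)"] in \<open>auto intro!: derivative_eq_intros\<close>)
  moreover have "(\<lambda>w. f (w + (of_int b, 0))) = (\<lambda>w. f w + (of_int b, 0))"
    by (auto simp: fun_eq_iff lift)
  moreover have "((\<lambda>w. f w + (of_int b, 0)) has_derivative frechet_derivative f (at (x, r))) (at (x, r))"
    by (auto intro!: derivative_eq_intros a)
  ultimately show ?thesis
    using has_derivative_unique by metis
qed

text \<open>For \<open>\<bar>r\<bar> \<le> B\<close>, periodicity and compactness bound \<open>\<bar>\<partial>\<Theta>/\<partial>\<theta>\<bar>\<close> by some \<open>L\<close> and \<open>\<partial>\<Theta>/\<partial>r\<close> from
below by some \<open>c > 0\<close>; comparing \<open>\<Theta>(x, r)\<close>, \<open>\<Theta>(x', r)\<close> and \<open>\<Theta>(x', r')\<close> then gives the constant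
\<open>L / c\<close>.\<close>

lemma radius_lipschitz:
  "\<exists>K\<ge>0. \<forall>x r x' r'. \<bar>r\<bar> \<le> B \<longrightarrow> \<bar>r'\<bar> \<le> B \<longrightarrow>
     \<bar>r - r'\<bar> \<le> K * (\<bar>x - x'\<bar> + \<bar>fst (f (x, r)) - fst (f (x', r'))\<bar>)"
proof -
  obtain tx tr where a: "\<And>z. (f has_derivative frechet_derivative f (at z)) (at z)"
    "\<And>z v. fst (frechet_derivative f (at z) v) = tx z * fst v + tr z * snd v"
    "\<And>x r. ((\<lambda>s. fst (f (s, r))) has_field_derivative tx (x, r)) (at x)"
    "\<And>x r. ((\<lambda>s. fst (f (x, s))) has_field_derivative tr (x, r)) (at r)"
    "continuous_on UNIV tx" "continuous_on UNIV tr" "\<And>z. 0 < tr z"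
    by (rule derivative_of_angle) blast
  note dx = a(3) and dr = a(4)
  have shift: "tx (x + of_int b, r) = tx (x, r)" "tr (x + of_int b, r) = tr (x, r)" for x b r
    using a(2)[of "(x + of_int b, r)" "(1, 0)"] a(2)[of "(x, r)" "(1, 0)"]
      a(2)[of "(x + of_int b, r)" "(0, 1)"] a(2)[of "(x, r)" "(0, 1)"]
    by (simp_all add: frechet_derivative_shift)
  let ?Q = "{0..1} \<times> {- B..B} :: (real \<times> real) set"
  have red: "\<exists>w\<in>?Q. tx (x, r) = tx w \<and> tr (x, r) = tr w" if "\<bar>r\<bar> \<le> B" for x r
  proof (rule bexI)
    show "tx (x, r) = tx (frac x, r) \<and> tr (x, r) = tr (frac x, r)"
      using shift[of "frac x" "\<lfloor>x\<rfloor>" r] by (simp add: frac_def)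
    show "(frac x, r) \<in> ?Q"
      using that frac_lt_1[of x] frac_ge_0[of x] by (simp add: abs_le_iff)
  qed
  show ?thesis
  proof (cases "0 \<le> B")
    case True
    then have ne: "?Q \<noteq> {}" and cp: "compact ?Q" by (auto intro: compact_Times)
    have ct: "continuous_on ?Q (\<lambda>z. \<bar>tx z\<bar>)" "continuous_on ?Q tr"
      using a(5,6) by (auto intro!: continuous_intros intro: continuous_on_subset)
    obtain u where u: "\<And>w. w \<in> ?Q \<Longrightarrow> \<bar>tx w\<bar> \<le> \<bar>tx u\<bar>"
      using continuous_attains_sup[OF cp ne ct(1)] by auto
    obtain l where l: "\<And>w. w \<in> ?Q \<Longrightarrow> tr l \<le> tr w"
      using continuous_attains_inf[OF cp ne ct(2)] by auto
    define L where "L = max 1 \<bar>tx u\<bar>"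
    define c where "c = tr l"
    have L: "\<bar>tx (x, r)\<bar> \<le> L" and c: "c \<le> tr (x, r)" if "\<bar>r\<bar> \<le> B" for x r
      using red[OF that, of x] u l by (force simp: L_def c_def)+
    have "0 < c" "1 \<le> L" by (simp_all add: c_def a L_def)
    have x_bound: "\<bar>fst (f (x, r)) - fst (f (x', r))\<bar> \<le> L * \<bar>x - x'\<bar>" if "\<bar>r\<bar> \<le> B" for x x' r
      using field_differentiable_bound[of UNIV "\<lambda>s. fst (f (s, r))" "\<lambda>s. tx (s, r)" L x x'] dx L[OF that]
      by auto
    have r_bound': "c * (r' - r) \<le> fst (f (x, r')) - fst (f (x, r))"
      if b: "\<bar>r\<bar> \<le> B" "\<bar>r'\<bar> \<le> B" "r < r'" for r r' x
    proof -
      obtain \<xi> where x: "r < \<xi>" "\<xi> < r'" "fst (f (x, r')) - fst (f (x, r)) = (r' - r) * tr (x, \<xi>)"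
        using MVT2[of r r' "\<lambda>s. fst (f (x, s))" "\<lambda>s. tr (x, s)"] dr b by blast
      have "(r' - r) * c \<le> (r' - r) * tr (x, \<xi>)"
        using x b by (intro mult_left_mono c) auto
      with x show ?thesis by (simp add: mult.commute)
    qed
    have r_bound: "c * \<bar>r - r'\<bar> \<le> \<bar>fst (f (x, r)) - fst (f (x, r'))\<bar>"
      if "\<bar>r\<bar> \<le> B" "\<bar>r'\<bar> \<le> B" for x r r'
      using r_bound'[OF that, of x] r_bound'[OF that(2,1), of x]
      by (cases r r' rule: linorder_cases) (auto simp: abs_if)
    have "\<bar>r - r'\<bar> \<le> L / c * (\<bar>x - x'\<bar> + \<bar>fst (f (x, r)) - fst (f (x', r'))\<bar>)"
      if b: "\<bar>r\<bar> \<le> B" "\<bar>r'\<bar> \<le> B" for x r x' r'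
    proof -
      have "c * \<bar>r - r'\<bar> \<le> \<bar>fst (f (x', r)) - fst (f (x', r'))\<bar>"
        by (rule r_bound[OF b])
      also have "\<dots> \<le> L * \<bar>x - x'\<bar> + \<bar>fst (f (x, r)) - fst (f (x', r'))\<bar>"
        using x_bound[OF b(1), of x x'] by linarith
      also have "\<dots> \<le> L * \<bar>x - x'\<bar> + L * \<bar>fst (f (x, r)) - fst (f (x', r'))\<bar>"
        using \<open>1 \<le> L\<close> by (intro add_left_mono mult_left_mono[of 1 L, simplified mult_1] ) (auto simp: mult_le_cancel_right1)
      finally show ?thesis using \<open>0 < c\<close> by (simp add: field_simps)
    qed
    moreover have "0 \<le> L / c" using \<open>0 < c\<close> \<open>1 \<le> L\<close> by simp
    ultimately show ?thesis by blast
  qed auto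
qed

end

section \<open>Periodic chains of twist maps\<close>

lemma sum_window_of_periodic:
  fixes c :: "int \<Rightarrow> real"
  assumes "\<And>n. c (n + K) = c n" "0 \<le> K"
  shows "sum c {k..<k + K} = sum c {0..<K}"
proof -
  have step: "sum c {i + 1..<i + 1 + K} = sum c {i..<i + K}" for i
  proof -
    have "insert i {i + 1..<i + 1 + K} = insert (i + K) {i..<i + K}"
      using assms(2) by auto
    then have "sum c (insert i {i + 1..<i + 1 + K}) = sum c (insert (i + K) {i..<i + K})"
      by simp
    then show ?thesis using assms(1)[of i] by simp
  qed
  show ?thesis
  proof (induction k rule: int_induct[where k = 0])
    case (step1 i)
    then show ?case using step[of i] by simp
  next
    case (step2 i)
    then show ?case using step[of "i - 1"] by simp
  qed simp
qed

text \<open>Instead of a composition of \<open>N\<close> maps one studies the chain in which \<open>g n\<close> is applied at time \<open>n\<close>.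
All \<open>N\<close> intermediate points of an orbit become visible, and each pair of consecutive points has a
generating function, which need not exist for the composition itself.\<close>

locale twist_chain =
  fixes g :: "int \<Rightarrow> real \<times> real \<Rightarrow> real \<times> real" and N :: nat and \<rho>p \<rho>m :: real
  assumes N_pos: "0 < N" and periodic: "g (n + int N) = g n" and in_class: "g n \<in> class_P \<rho>p \<rho>m"
begin

sublocale link: twist_map "g n" \<rho>p \<rho>m for n :: int
  by unfold_locales (rule in_class)

abbreviation "strip \<equiv> link.strip"

lemma periodic_mult: "g (n + a * int N) = g n"
proof (induction a rule: int_induct[where k = 0])
  case (step1 i)
  then show ?case using periodic[of "n + i * int N"] by (simp add: algebra_simps)
next
  case (step2 i)
  then show ?case using periodic[of "n + (i - 1) * int N"] by (simp add: algebra_simps)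
qed simp

text \<open>Only \<open>N\<close> different maps occur, so a constant that exists for each of them and may be enlarged can be
chosen once for all.\<close>

lemma uniform_constant:
  fixes P :: "(real \<times> real \<Rightarrow> real \<times> real) \<Rightarrow> real \<Rightarrow> bool"
  assumes "\<And>n. \<exists>C. P (g n) C" "\<And>f C C'. P f C \<Longrightarrow> C \<le> C' \<Longrightarrow> P f C'"
  shows "\<exists>C. \<forall>n. P (g n) C"
proof -
  obtain C where C: "\<And>n. P (g n) (C n)" using assms(1) by metis
  define C' where "C' = Max (C ` {0..<int N})"
  have "P (g n) C'" for n
  proof -
    have "P (g (n mod int N)) (C (n mod int N))" by (rule C)
    moreover have "g (n mod int N) = g n"
      using periodic_mult[of "n mod int N" "n div int N"] by (simp add: mod_div_mult_eq)
    moreover have "C (n mod int N) \<le> C'"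
      unfolding C'_def using N_pos by (intro Max_ge) auto
    ultimately show ?thesis using assms(2) by metis
  qed
  then show ?thesis by blast
qed

lemma uniform_displacement: "\<exists>M\<ge>0. \<forall>n z. \<bar>snd (g n z) - snd z\<bar> \<le> M"
proof -
  have "\<exists>C. \<forall>n. 0 \<le> C \<and> (\<forall>z. \<bar>snd (g n z) - snd z\<bar> \<le> C)"
  proof (rule uniform_constant)
    fix n
    obtain M where "\<And>z. \<bar>snd (g n z) - snd z\<bar> \<le> M" using link.radius_displacement_bounded by blast
    then show "\<exists>C. 0 \<le> C \<and> (\<forall>z. \<bar>snd (g n z) - snd z\<bar> \<le> C)"
      using order_trans[OF abs_ge_zero] by blast
  qed (meson order_trans)
  then show ?thesis by blast
qed

lemma uniform_step:
  assumes "0 < \<delta>"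
  shows "\<exists>C. \<forall>n x r. (C \<le> r \<longrightarrow> \<rho>p - \<delta> < fst (g n (x, r)) - x) \<and>
     (r \<le> - C \<longrightarrow> fst (g n (x, r)) - x < \<rho>m + \<delta>)"
proof (rule uniform_constant[where P = "\<lambda>f C. \<forall>x r. (C \<le> r \<longrightarrow> \<rho>p - \<delta> < fst (f (x, r)) - x) \<and>
     (r \<le> - C \<longrightarrow> fst (f (x, r)) - x < \<rho>m + \<delta>)"])
  fix n
  obtain C where C: "\<And>x r. C \<le> r \<Longrightarrow> \<rho>p - \<delta> < fst (g n (x, r)) - x"
    using link.step_tendsto_top[OF assms] by blast
  obtain D where D: "\<And>x r. r \<le> D \<Longrightarrow> fst (g n (x, r)) - x < \<rho>m + \<delta>"
    using link.step_tendsto_bot[OF assms] by blast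
  show "\<exists>C. \<forall>x r. (C \<le> r \<longrightarrow> \<rho>p - \<delta> < fst (g n (x, r)) - x) \<and>
     (r \<le> - C \<longrightarrow> fst (g n (x, r)) - x < \<rho>m + \<delta>)"
    by (rule exI[of _ "max C (- D)"]) (auto intro: C D)
qed force

lemma uniform_radius:
  "\<exists>\<epsilon>>0. \<forall>n x y. (x, y) \<in> strip \<longrightarrow>
     (\<rho>p - \<epsilon> \<le> y - x \<longrightarrow> L \<le> link.radius n x y) \<and> (y - x \<le> \<rho>m + \<epsilon> \<longrightarrow> link.radius n x y \<le> - L)"
proof -
  \<comment> \<open>writing the threshold as \<open>exp (- C)\<close> turns "small and positive" into "\<open>C\<close> large"\<close>
  have "\<exists>C. \<forall>n. \<forall>x y. (x, y) \<in> strip \<longrightarrow>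
     (\<rho>p - exp (- C) \<le> y - x \<longrightarrow> L \<le> link.radius n x y) \<and>
     (y - x \<le> \<rho>m + exp (- C) \<longrightarrow> link.radius n x y \<le> - L)"
  proof (rule uniform_constant[where P = "\<lambda>f C. \<forall>x y. (x, y) \<in> strip \<longrightarrow>
     (\<rho>p - exp (- C) \<le> y - x \<longrightarrow> L \<le> twist_map.radius f x y) \<and>
     (y - x \<le> \<rho>m + exp (- C) \<longrightarrow> twist_map.radius f x y \<le> - L)"])
    fix n
    obtain e where e: "0 < e" "\<And>x y. (x, y) \<in> strip \<Longrightarrow> \<rho>p - e \<le> y - x \<Longrightarrow> L \<le> link.radius n x y"
      using link.radius_large by blast
    obtain d where d: "0 < d" "\<And>x y. (x, y) \<in> strip \<Longrightarrow> y - x \<le> \<rho>m + d \<Longrightarrow> link.radius n x y \<le> - L"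
      using link.radius_small by blast
    have "exp (- (- ln (min e d))) = min e d" using e d by simp
    then show "\<exists>C. \<forall>x y. (x, y) \<in> strip \<longrightarrow>
     (\<rho>p - exp (- C) \<le> y - x \<longrightarrow> L \<le> link.radius n x y) \<and>
     (y - x \<le> \<rho>m + exp (- C) \<longrightarrow> link.radius n x y \<le> - L)"
      by (intro exI[of _ "- ln (min e d)"]) (auto intro!: e(2) d(2))
  next
    fix f :: "real \<times> real \<Rightarrow> real \<times> real" and C C' :: real
    assume P: "\<forall>x y. (x, y) \<in> strip \<longrightarrow>
     (\<rho>p - exp (- C) \<le> y - x \<longrightarrow> L \<le> twist_map.radius f x y) \<and>
     (y - x \<le> \<rho>m + exp (- C) \<longrightarrow> twist_map.radius f x y \<le> - L)" and "C \<le> C'"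
    then have "exp (- C') \<le> exp (- C)" by simp
    then have "\<rho>p - exp (- C) \<le> \<rho>p - exp (- C')" "\<rho>m + exp (- C') \<le> \<rho>m + exp (- C)" by simp_all
    with P show "\<forall>x y. (x, y) \<in> strip \<longrightarrow>
     (\<rho>p - exp (- C') \<le> y - x \<longrightarrow> L \<le> twist_map.radius f x y) \<and>
     (y - x \<le> \<rho>m + exp (- C') \<longrightarrow> twist_map.radius f x y \<le> - L)" by (meson order_trans)
  qed
  then obtain C where C: "\<forall>n x y. (x, y) \<in> strip \<longrightarrow>
     (\<rho>p - exp (- C) \<le> y - x \<longrightarrow> L \<le> link.radius n x y) \<and>
     (y - x \<le> \<rho>m + exp (- C) \<longrightarrow> link.radius n x y \<le> - L)" by blast
  show ?thesis by (rule exI[of _ "exp (- C)"]) (use C in simp)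
qed

definition orbit :: "(int \<Rightarrow> real \<times> real) \<Rightarrow> bool" where
  "orbit z \<longleftrightarrow> (\<forall>n. z (n + 1) = g n (z n))"

lemma orbit_unique:
  assumes "orbit z" "orbit z'" "z m = z' m"
  shows "z = z'"
proof
  fix n
  show "z n = z' n"
  proof (induction n rule: int_induct[where k = m])
    case base
    show ?case by (rule assms(3))
  next
    case (step1 i)
    then show ?case using assms(1,2) by (simp add: orbit_def)
  next
    case (step2 i)
    have "z i = g (i - 1) (z (i - 1))" "z' i = g (i - 1) (z' (i - 1))"
      using assms(1,2) by (metis orbit_def diff_add_cancel)+
    then show ?case using step2 bij_is_inj[OF link.bij] by (metis injD)
  qed
qed

lemma orbit_translate: "orbit z \<Longrightarrow> orbit (\<lambda>n. z (n + a * int N) + (of_int b, 0))"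
  unfolding orbit_def
proof
  fix n
  assume "\<forall>n. z (n + 1) = g n (z n)"
  then have "z (n + a * int N + 1) = g (n + a * int N) (z (n + a * int N))" by blast
  moreover have "g n (z (n + a * int N) + (of_int b, 0)) = g n (z (n + a * int N)) + (of_int b, 0)"
    using link.lift[of n "fst (z (n + a * int N))" b "snd (z (n + a * int N))"]
    by (simp add: plus_prod_def)
  ultimately show "z (n + 1 + a * int N) + (of_int b, 0) = g n (z (n + a * int N) + (of_int b, 0))"
    by (simp add: periodic_mult add_ac)
qed

section \<open>Periodic minimisers of the action\<close>

text \<open>Sequences of mean step \<open>p / K\<close>. The margin \<open>\<epsilon>\<close> keeps consecutive pairs in a closed part of the strip,
which gives compactness at the price of walls that a minimiser might touch.\<close>

definition configs :: "int \<Rightarrow> int \<Rightarrow> real \<Rightarrow> (int \<Rightarrow> real) set" where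
  "configs K p \<epsilon> = {x. (\<forall>n. x (n + K) = x n + of_int p) \<and>
     (\<forall>n. \<rho>m + \<epsilon> \<le> x (n + 1) - x n) \<and> (\<forall>n. x (n + 1) - x n \<le> \<rho>p - \<epsilon>)}"

definition action :: "int \<Rightarrow> (int \<Rightarrow> real) \<Rightarrow> real" where
  "action K x = (\<Sum>n = 0..<K. link.gen n (x n, x (n + 1)))"

definition minimizers :: "int \<Rightarrow> int \<Rightarrow> real \<Rightarrow> (int \<Rightarrow> real) set" where
  "minimizers K p \<epsilon> = {x \<in> configs K p \<epsilon>. \<forall>y \<in> configs K p \<epsilon>. action K x \<le> action K y}"

end

text \<open>With \<open>K \<ge> 2\<close> no site is its own neighbour, so moving one site and its periodic copies changes just
two terms of the action over a period.\<close>

locale periodic_problem = twist_chain +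
  fixes K p :: int and \<epsilon> :: real
  assumes N_dvd_K: "int N dvd K" and K_ge_2: "2 \<le> K" and \<epsilon>_pos: "0 < \<epsilon>"
begin

abbreviation "confs \<equiv> configs K p \<epsilon>"
abbreviation "minims \<equiv> minimizers K p \<epsilon>"

lemma confsD:
  assumes "x \<in> confs"
  shows "x (n + K) = x n + of_int p" "\<rho>m + \<epsilon> \<le> x (n + 1) - x n" "x (n + 1) - x n \<le> \<rho>p - \<epsilon>"
    "(x n, x (n + 1)) \<in> strip"
proof -
  show *: "x (n + K) = x n + of_int p" "\<rho>m + \<epsilon> \<le> x (n + 1) - x n" "x (n + 1) - x n \<le> \<rho>p - \<epsilon>"
    using assms by (auto simp: configs_def)
  then show "(x n, x (n + 1)) \<in> strip" using \<epsilon>_pos by (simp add: link.strip_iff)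
qed

lemma confs_period_mult:
  assumes "x \<in> confs"
  shows "x (n + j * K) = x n + of_int (j * p)"
proof (induction j rule: int_induct[where k = 0])
  case (step1 i)
  then show ?case using confsD(1)[OF assms, of "n + i * K"] by (simp add: algebra_simps)
next
  case (step2 i)
  then show ?case using confsD(1)[OF assms, of "n + (i - 1) * K"] by (simp add: algebra_simps)
qed simp

lemma g_period: "g (n + K) = g n"
  using periodic_mult N_dvd_K by (metis dvdE mult.commute)

lemma action_window:
  assumes "x \<in> confs"
  shows "(\<Sum>n = k..<k + K. link.gen n (x n, x (n + 1))) = action K x"
  unfolding action_def
proof (rule sum_window_of_periodic)
  fix n
  have "x (n + K) = x n + of_int p" "x (n + K + 1) = x (n + 1) + of_int p"
    using confsD(1)[OF assms, of n] confsD(1)[OF assms, of "n + 1"] by (simp_all add: add_ac)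
  then show "link.gen (n + K) (x (n + K), x (n + K + 1)) = link.gen n (x n, x (n + 1))"
    using link.gen_shift[OF confsD(4)[OF assms, of n], of n p] by (simp add: g_period)
qed (use K_ge_2 in simp)

lemma translate_confs:
  assumes "x \<in> confs"
  shows "(\<lambda>n. x (n + a * int N) + of_int b) \<in> confs"
proof -
  have "x (n + K + a * int N) = x (n + a * int N) + of_int p"
    "\<rho>m + \<epsilon> \<le> x (n + 1 + a * int N) - x (n + a * int N)"
    "x (n + 1 + a * int N) - x (n + a * int N) \<le> \<rho>p - \<epsilon>" for n
    using confsD[OF assms, of "n + a * int N"] by (simp_all add: add_ac)
  then show ?thesis by (simp add: configs_def)
qed

lemma translate_action:
  assumes "x \<in> confs"
  shows "action K (\<lambda>n. x (n + a * int N) + of_int b) = action K x"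
proof -
  let ?k = "a * int N"
  have "action K (\<lambda>n. x (n + ?k) + of_int b) = (\<Sum>n = 0..<K. link.gen (n + ?k) (x (n + ?k), x (n + ?k + 1)))"
    unfolding action_def
  proof (rule sum.cong[OF refl])
    fix n
    show "link.gen n (x (n + ?k) + of_int b, x (n + 1 + ?k) + of_int b) =
        link.gen (n + ?k) (x (n + ?k), x (n + ?k + 1))"
      using link.gen_shift[OF confsD(4)[OF assms, of "n + ?k"], of n b] by (simp add: periodic_mult add_ac)
  qed
  also have "\<dots> = (\<Sum>n = ?k..<?k + K. link.gen n (x n, x (n + 1)))"
    by (rule sum.reindex_bij_witness[of _ "\<lambda>n. n - ?k" "\<lambda>n. n + ?k"]) auto
  finally show ?thesis by (simp add: action_window[OF assms])
qed

lemma translate_minims: "x \<in> minims \<Longrightarrow> (\<lambda>n. x (n + a * int N) + of_int b) \<in> minims"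
  by (simp add: minimizers_def translate_confs translate_action)

lemma confs_bound:
  assumes "x \<in> confs"
  shows "\<bar>x n - x 0\<bar> \<le> \<bar>of_int n\<bar> * (\<bar>\<rho>p\<bar> + \<bar>\<rho>m\<bar>)"
proof -
  have step: "\<bar>x (i + 1) - x i\<bar> \<le> \<bar>\<rho>p\<bar> + \<bar>\<rho>m\<bar>" for i
    using confsD(2,3)[OF assms, of i] \<epsilon>_pos by linarith
  show ?thesis
  proof (induction n rule: int_induct[where k = 0])
    case (step1 i)
    have "\<bar>real_of_int (i + 1)\<bar> = \<bar>real_of_int i\<bar> + 1" using step1(1) by simp
    then show ?case using step1 step[of i] by (simp only: distrib_right mult_1) linarith
  next
    case (step2 i)
    have "\<bar>real_of_int (i - 1)\<bar> = \<bar>real_of_int i\<bar> + 1" using step2(1) by simp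
    then show ?case using step2 step[of "i - 1"]
      by (simp only: distrib_right mult_1 diff_add_cancel) linarith
  qed simp
qed

lemma compact_normalized_confs: "compact (confs \<inter> {x. x 0 \<in> {0..1}})"
proof -
  define S where "S n = {- (\<bar>of_int n\<bar> * (\<bar>\<rho>p\<bar> + \<bar>\<rho>m\<bar>)) .. 1 + \<bar>of_int n\<bar> * (\<bar>\<rho>p\<bar> + \<bar>\<rho>m\<bar>)}" for n :: int
  have "compactin (product_topology (\<lambda>_. euclidean) UNIV) (PiE UNIV S)"
    unfolding compactin_PiE by (simp add: S_def)
  then have "compact (PiE UNIV S)" by (simp add: euclidean_product_topology)
  moreover have "closed (confs \<inter> {x. x 0 \<in> {0..1}})"
    unfolding configs_def atLeastAtMost_iff Collect_conj_eq
    by (intro closed_Int closed_Collect_all closed_Collect_eq closed_Collect_le continuous_intros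
        continuous_on_product_coordinates)
  moreover have "confs \<inter> {x. x 0 \<in> {0..1}} \<subseteq> PiE UNIV S"
  proof
    fix x assume x: "x \<in> confs \<inter> {x. x 0 \<in> {0..1}}"
    have "x n \<in> S n" for n
      using x confs_bound[of x n] by (auto simp: S_def)
    then show "x \<in> PiE UNIV S" by (simp add: PiE_iff)
  qed
  ultimately show ?thesis by (metis compact_Int_closed inf.absorb2)
qed

lemma continuous_action: "continuous_on confs (action K)"
  unfolding action_def
proof (intro continuous_on_sum)
  fix n
  have "continuous_on confs (\<lambda>x. (x n, x (n + 1)))"
    by (intro continuous_intros continuous_on_subset[OF continuous_on_product_coordinates]) auto
  then show "continuous_on confs (\<lambda>x. link.gen n (x n, x (n + 1)))"
    by (rule continuous_on_compose2[OF link.continuous_gen]) (auto intro: confsD(4))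
qed

lemma minims_nonempty:
  assumes "confs \<noteq> {}"
  shows "minims \<noteq> {}"
proof -
  let ?C = "confs \<inter> {x. x 0 \<in> {0..1}}"
  have normal: "\<exists>x' \<in> ?C. action K x' = action K x" if "x \<in> confs" for x
  proof -
    let ?x = "\<lambda>n. x (n + 0 * int N) + of_int (- \<lfloor>x 0\<rfloor>)"
    have "?x 0 = frac (x 0)" by (simp add: frac_def)
    then have "?x 0 \<in> {0..1}" using frac_ge_0[of "x 0"] frac_lt_1[of "x 0"] by simp
    with translate_confs[OF that, of 0 "- \<lfloor>x 0\<rfloor>"] translate_action[OF that, of 0 "- \<lfloor>x 0\<rfloor>"]
    show ?thesis by blast
  qed
  have "?C \<noteq> {}" using assms normal by blast
  moreover have "continuous_on ?C (action K)"
    by (rule continuous_on_subset[OF continuous_action]) simp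
  ultimately obtain x where "x \<in> ?C" and x: "\<And>y. y \<in> ?C \<Longrightarrow> action K x \<le> action K y"
    using continuous_attains_inf[OF compact_normalized_confs] by metis
  have "action K x \<le> action K y" if "y \<in> confs" for y
    using normal[OF that] x by metis
  with \<open>x \<in> ?C\<close> have "x \<in> minims" by (simp add: minimizers_def)
  then show ?thesis by blast
qed

lemma minims_local:
  assumes x: "x \<in> minims"
    and s: "\<rho>m + \<epsilon> \<le> x (b + 1) + s - x b" "x (b + 1) + s - x b \<le> \<rho>p - \<epsilon>"
      "\<rho>m + \<epsilon> \<le> x (b + 2) - (x (b + 1) + s)" "x (b + 2) - (x (b + 1) + s) \<le> \<rho>p - \<epsilon>"
  shows "link.gen b (x b, x (b + 1)) + link.gen (b + 1) (x (b + 1), x (b + 2)) \<le>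
    link.gen b (x b, x (b + 1) + s) + link.gen (b + 1) (x (b + 1) + s, x (b + 2))"
proof -
  have xc: "x \<in> confs" using x by (simp add: minimizers_def)
  define x' where "x' n = (if K dvd n - (b + 1) then x n + s else x n)" for n
  have val: "x n - x (n - 1) = x (b + 1) - x b" "x (n + 1) - x n = x (b + 2) - x (b + 1)"
    if dvd: "K dvd n - (b + 1)" for n
  proof -
    obtain j where "n - (b + 1) = K * j" using dvd by blast
    then have "n = b + 1 + j * K" by (simp add: mult.commute)
    then have "x n = x (b + 1) + of_int (j * p)" "x (n - 1) = x b + of_int (j * p)"
      "x (n + 1) = x (b + 2) + of_int (j * p)"
      using confs_period_mult[OF xc, of "b + 1" j] confs_period_mult[OF xc, of "b" j]
        confs_period_mult[OF xc, of "b + 2" j] by (simp_all add: add_ac)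
    then show "x n - x (n - 1) = x (b + 1) - x b" "x (n + 1) - x n = x (b + 2) - x (b + 1)" by simp_all
  qed
  have excl: "\<not> (K dvd n - (b + 1) \<and> K dvd n + 1 - (b + 1))" for n
  proof
    assume "K dvd n - (b + 1) \<and> K dvd n + 1 - (b + 1)"
    then have "K dvd (n + 1 - (b + 1)) - (n - (b + 1))" using dvd_diff by blast
    then show False using K_ge_2 by (simp add: zdvd1_eq)
  qed
  have "x' \<in> confs"
    unfolding configs_def mem_Collect_eq
  proof (intro conjI allI)
    fix n
    have "K dvd n + K - (b + 1) \<longleftrightarrow> K dvd n - (b + 1)"
      using dvd_add_left_iff[of K K "n - (b + 1)"] by (simp add: algebra_simps)
    then show "x' (n + K) = x' n + of_int p" by (simp add: x'_def confsD(1)[OF xc])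
    show "\<rho>m + \<epsilon> \<le> x' (n + 1) - x' n" "x' (n + 1) - x' n \<le> \<rho>p - \<epsilon>"
      using excl[of n] s val(1)[of "n + 1"] val(2)[of n] confsD(2,3)[OF xc, of n]
      by (auto simp: x'_def)
  qed
  then have "action K x \<le> action K x'" using x by (simp add: minimizers_def)
  moreover have "action K y = link.gen b (y b, y (b + 1)) + link.gen (b + 1) (y (b + 1), y (b + 2)) +
      (\<Sum>n = b + 2..<b + K. link.gen n (y n, y (n + 1)))" if "y \<in> confs" for y
  proof -
    have "{b..<b + K} = insert b (insert (b + 1) {b + 2..<b + K})" using K_ge_2 by auto
    then show ?thesis using action_window[OF that, of b] by (simp add: add_ac)
  qed
  moreover have "(\<Sum>n = b + 2..<b + K. link.gen n (x' n, x' (n + 1))) = (\<Sum>n = b + 2..<b + K. link.gen n (x n, x (n + 1)))"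
  proof (rule sum.cong[OF refl])
    fix n assume n: "n \<in> {b + 2..<b + K}"
    then have "\<not> K dvd n - (b + 1)" "\<not> K dvd n + 1 - (b + 1)"
      by (auto dest!: zdvd_imp_le)
    then show "link.gen n (x' n, x' (n + 1)) = link.gen n (x n, x (n + 1))" by (simp add: x'_def)
  qed
  moreover have "x' b = x b" "x' (b + 1) = x (b + 1) + s" "x' (b + 2) = x (b + 2)"
    using K_ge_2 by (auto simp: x'_def zdvd1_eq)
  ultimately show ?thesis using xc \<open>x' \<in> confs\<close> by simp
qed

lemma gen_pair_derivative:
  assumes "x \<in> confs"
  shows "((\<lambda>s. link.gen b (x b, s) + link.gen (b + 1) (s, x (b + 2)))
    has_field_derivative link.image_radius b (x b) (x (b + 1)) - link.radius (b + 1) (x (b + 1)) (x (b + 2)))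
    (at (x (b + 1)))"
  using DERIV_add[OF link.gen_partial2[OF confsD(4)[OF assms, of b], of b]
    link.gen_partial1[of "x (b + 1)" "x (b + 2)" "b + 1"]] confsD(4)[OF assms, of "b + 1"]
  by (simp add: add_ac)

text \<open>Moving a site down is allowed as soon as neither adjacent step is thereby pushed into its wall. The
derivative of the action under this one-sided move then has a sign.\<close>

lemma minims_push_down:
  assumes x: "x \<in> minims" and slack: "\<rho>m + \<epsilon> < x (b + 1) - x b" "x (b + 2) - x (b + 1) < \<rho>p - \<epsilon>"
  shows "link.image_radius b (x b) (x (b + 1)) \<le> link.radius (b + 1) (x (b + 1)) (x (b + 2))"
proof (rule ccontr)
  assume "\<not> ?thesis"
  then have pos: "0 < link.image_radius b (x b) (x (b + 1)) - link.radius (b + 1) (x (b + 1)) (x (b + 2))"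
    by simp
  have xc: "x \<in> confs" using x by (simp add: minimizers_def)
  from DERIV_pos_inc_left[OF gen_pair_derivative[OF xc] pos] obtain d where "0 < d" and
    d: "\<And>h. 0 < h \<Longrightarrow> h < d \<Longrightarrow>
      link.gen b (x b, x (b + 1) - h) + link.gen (b + 1) (x (b + 1) - h, x (b + 2)) <
      link.gen b (x b, x (b + 1)) + link.gen (b + 1) (x (b + 1), x (b + 2))" by auto
  obtain h where h: "0 < h" "h < d" "h < x (b + 1) - x b - (\<rho>m + \<epsilon>)" "h < \<rho>p - \<epsilon> - (x (b + 2) - x (b + 1))"
    using field_lbound_gt_zero[of d "min (x (b + 1) - x b - (\<rho>m + \<epsilon>)) (\<rho>p - \<epsilon> - (x (b + 2) - x (b + 1)))"]
      \<open>0 < d\<close> slack by auto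
  have "link.gen b (x b, x (b + 1)) + link.gen (b + 1) (x (b + 1), x (b + 2)) \<le>
    link.gen b (x b, x (b + 1) + - h) + link.gen (b + 1) (x (b + 1) + - h, x (b + 2))"
    using h confsD(2,3)[OF xc, of b] confsD(2,3)[OF xc, of "b + 1"]
    by (intro minims_local x) (simp_all add: add_ac)
  with d[OF h(1,2)] show False by simp
qed

lemma minims_push_up:
  assumes x: "x \<in> minims" and slack: "x (b + 1) - x b < \<rho>p - \<epsilon>" "\<rho>m + \<epsilon> < x (b + 2) - x (b + 1)"
  shows "link.radius (b + 1) (x (b + 1)) (x (b + 2)) \<le> link.image_radius b (x b) (x (b + 1))"
proof (rule ccontr)
  assume "\<not> ?thesis"
  then have neg: "link.image_radius b (x b) (x (b + 1)) - link.radius (b + 1) (x (b + 1)) (x (b + 2)) < 0"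
    by simp
  have xc: "x \<in> confs" using x by (simp add: minimizers_def)
  from DERIV_neg_dec_right[OF gen_pair_derivative[OF xc] neg] obtain d where "0 < d" and
    d: "\<And>h. 0 < h \<Longrightarrow> h < d \<Longrightarrow>
      link.gen b (x b, x (b + 1) + h) + link.gen (b + 1) (x (b + 1) + h, x (b + 2)) <
      link.gen b (x b, x (b + 1)) + link.gen (b + 1) (x (b + 1), x (b + 2))" by auto
  obtain h where h: "0 < h" "h < d" "h < \<rho>p - \<epsilon> - (x (b + 1) - x b)" "h < x (b + 2) - x (b + 1) - (\<rho>m + \<epsilon>)"
    using field_lbound_gt_zero[of d "min (\<rho>p - \<epsilon> - (x (b + 1) - x b)) (x (b + 2) - x (b + 1) - (\<rho>m + \<epsilon>))"]
      \<open>0 < d\<close> slack by auto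
  have "link.gen b (x b, x (b + 1)) + link.gen (b + 1) (x (b + 1), x (b + 2)) \<le>
    link.gen b (x b, x (b + 1) + h) + link.gen (b + 1) (x (b + 1) + h, x (b + 2))"
    using h confsD(2,3)[OF xc, of b] confsD(2,3)[OF xc, of "b + 1"]
    by (intro minims_local x) (simp_all add: add_ac)
  with d[OF h(1,2)] show False by simp
qed

lemma step_of_radius: "x \<in> confs \<Longrightarrow> fst (g n (x n, link.radius n (x n) (x (n + 1)))) = x (n + 1)"
  by (rule link.angle_radius) (rule confsD(4))

text \<open>A step at the upper wall starts at a height of at least \<open>C + K M\<close>. The next step either is again at
the wall, hence starts as high, or leaves room to move the site between them down, so that by
\<open>minims_push_down\<close> it starts no lower than the image of the previous point, i.e. at most \<open>M\<close> lower.
Over a whole period the height stays above \<open>C\<close>, and all steps exceed \<open>\<rho>p - \<delta>\<close>, which is more than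
their mean.\<close>

lemma minims_below_upper_wall:
  assumes x: "x \<in> minims"
    and mean: "of_int p < of_int K * (\<rho>p - \<delta>)" and "\<rho>m + \<epsilon> < \<rho>p - \<delta>"
    and M: "\<And>n z. \<bar>snd (g n z) - snd z\<bar> \<le> M"
    and C: "\<And>n x r. C \<le> r \<Longrightarrow> \<rho>p - \<delta> < fst (g n (x, r)) - x"
    and wall: "\<And>n x y. (x, y) \<in> strip \<Longrightarrow> \<rho>p - \<epsilon> \<le> y - x \<Longrightarrow> C + of_int K * M \<le> link.radius n x y"
  shows "x (m + 1) - x m < \<rho>p - \<epsilon>"
proof (rule ccontr)
  have xc: "x \<in> confs" using x by (simp add: minimizers_def)
  assume "\<not> ?thesis"
  then have wall_m: "\<rho>p - \<epsilon> \<le> x (m + 1) - x m" by simp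
  have "0 \<le> M" using M[of 0 "(0, 0)"] by linarith
  let ?r = "\<lambda>n. link.radius n (x n) (x (n + 1))"
  have "j \<le> nat K \<longrightarrow> C + of_int K * M - of_nat j * M \<le> ?r (m + int j) \<and> x m + of_nat j * (\<rho>p - \<delta>) \<le> x (m + int j)" for j
  proof (induction j)
    case 0
    then show ?case using wall[OF confsD(4)[OF xc] wall_m] by simp
  next
    case (Suc j)
    show ?case
    proof
      let ?n = "m + int j"
      assume j: "Suc j \<le> nat K"
      with Suc have IH: "C + of_int K * M - of_nat j * M \<le> ?r ?n" "x m + of_nat j * (\<rho>p - \<delta>) \<le> x ?n"
        by simp_all
      have "of_nat j \<le> (of_int K :: real)" using j by linarith
      then have "of_nat j * M \<le> of_int K * M" using \<open>0 \<le> M\<close> by (rule mult_right_mono)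
      then have step: "\<rho>p - \<delta> < x (?n + 1) - x ?n"
        using C[of "?r ?n" ?n "x ?n"] IH(1) step_of_radius[OF xc, of ?n] by simp
      have "C + of_int K * M - of_nat (Suc j) * M \<le> ?r (?n + 1)"
      proof (cases "x (?n + 2) - x (?n + 1) < \<rho>p - \<epsilon>")
        case True
        have "link.image_radius ?n (x ?n) (x (?n + 1)) \<le> ?r (?n + 1)"
          using minims_push_down[OF x _ True] step assms(3) by (simp add: add_ac)
        moreover have "?r ?n - M \<le> link.image_radius ?n (x ?n) (x (?n + 1))"
          using M[of ?n "(x ?n, ?r ?n)"] by (simp add: link.image_radius_def)
        ultimately show ?thesis using IH(1) by (simp add: algebra_simps)
      next
        case False
        then have "C + of_int K * M \<le> ?r (?n + 1)"
          using wall[OF confsD(4)[OF xc, of "?n + 1"]] by (simp add: add_ac)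
        moreover have "0 \<le> of_nat (Suc j) * M" using \<open>0 \<le> M\<close> by simp
        ultimately show ?thesis by linarith
      qed
      moreover have "x m + of_nat (Suc j) * (\<rho>p - \<delta>) \<le> x (?n + 1)"
        using IH(2) step by (simp add: algebra_simps)
      moreover have "m + int (Suc j) = ?n + 1" by simp
      ultimately show "C + of_int K * M - of_nat (Suc j) * M \<le> ?r (m + int (Suc j)) \<and>
          x m + of_nat (Suc j) * (\<rho>p - \<delta>) \<le> x (m + int (Suc j))"
        by metis
    qed
  qed
  from this[of "nat K"] have "x m + of_int K * (\<rho>p - \<delta>) \<le> x (m + K)"
    using K_ge_2 by simp
  then show False using confsD(1)[OF xc, of m] mean by simp
qed

text \<open>The mirror image of the previous argument, with heights close to \<open>- \<infinity>\<close>.\<close>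

lemma minims_above_lower_wall:
  assumes x: "x \<in> minims"
    and mean: "of_int K * (\<rho>m + \<delta>) < of_int p" and "\<rho>m + \<delta> < \<rho>p - \<epsilon>"
    and M: "\<And>n z. \<bar>snd (g n z) - snd z\<bar> \<le> M"
    and C: "\<And>n x r. r \<le> - C \<Longrightarrow> fst (g n (x, r)) - x < \<rho>m + \<delta>"
    and wall: "\<And>n x y. (x, y) \<in> strip \<Longrightarrow> y - x \<le> \<rho>m + \<epsilon> \<Longrightarrow> link.radius n x y \<le> - (C + of_int K * M)"
  shows "\<rho>m + \<epsilon> < x (m + 1) - x m"
proof (rule ccontr)
  have xc: "x \<in> confs" using x by (simp add: minimizers_def)
  assume "\<not> ?thesis"
  then have wall_m: "x (m + 1) - x m \<le> \<rho>m + \<epsilon>" by simp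
  have "0 \<le> M" using M[of 0 "(0, 0)"] by linarith
  let ?r = "\<lambda>n. link.radius n (x n) (x (n + 1))"
  have "j \<le> nat K \<longrightarrow> ?r (m + int j) \<le> - (C + of_int K * M - of_nat j * M) \<and> x (m + int j) \<le> x m + of_nat j * (\<rho>m + \<delta>)" for j
  proof (induction j)
    case 0
    then show ?case using wall[OF confsD(4)[OF xc] wall_m] by simp
  next
    case (Suc j)
    show ?case
    proof
      let ?n = "m + int j"
      assume j: "Suc j \<le> nat K"
      with Suc have IH: "?r ?n \<le> - (C + of_int K * M - of_nat j * M)" "x ?n \<le> x m + of_nat j * (\<rho>m + \<delta>)"
        by simp_all
      have "of_nat j \<le> (of_int K :: real)" using j by linarith
      then have "of_nat j * M \<le> of_int K * M" using \<open>0 \<le> M\<close> by (rule mult_right_mono)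
      then have step: "x (?n + 1) - x ?n < \<rho>m + \<delta>"
        using C[of "?r ?n" ?n "x ?n"] IH(1) step_of_radius[OF xc, of ?n] by simp
      have "?r (?n + 1) \<le> - (C + of_int K * M - of_nat (Suc j) * M)"
      proof (cases "\<rho>m + \<epsilon> < x (?n + 2) - x (?n + 1)")
        case True
        have "?r (?n + 1) \<le> link.image_radius ?n (x ?n) (x (?n + 1))"
          using minims_push_up[OF x _ True] step assms(3) by (simp add: add_ac)
        moreover have "link.image_radius ?n (x ?n) (x (?n + 1)) \<le> ?r ?n + M"
          using M[of ?n "(x ?n, ?r ?n)"] by (simp add: link.image_radius_def)
        ultimately show ?thesis using IH(1) by (simp add: algebra_simps)
      next
        case False
        then have "?r (?n + 1) \<le> - (C + of_int K * M)"
          using wall[OF confsD(4)[OF xc, of "?n + 1"]] by (simp add: add_ac)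
        moreover have "0 \<le> of_nat (Suc j) * M" using \<open>0 \<le> M\<close> by simp
        ultimately show ?thesis by linarith
      qed
      moreover have "x (?n + 1) \<le> x m + of_nat (Suc j) * (\<rho>m + \<delta>)"
        using IH(2) step by (simp add: algebra_simps)
      moreover have "m + int (Suc j) = ?n + 1" by simp
      ultimately show "?r (m + int (Suc j)) \<le> - (C + of_int K * M - of_nat (Suc j) * M) \<and>
          x (m + int (Suc j)) \<le> x m + of_nat (Suc j) * (\<rho>m + \<delta>)"
        by metis
    qed
  qed
  from this[of "nat K"] have "x (m + K) \<le> x m + of_int K * (\<rho>m + \<delta>)"
    using K_ge_2 by simp
  then show False using confsD(1)[OF xc, of m] mean by simp
qed

text \<open>Pointwise minima and maxima of configurations are configurations, and by submodularity of the
generating functions they do not increase the total action, strictly decreasing it at a crossing. Since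
both new configurations compete with the minimum, minimisers are closed under these operations and do
not cross.\<close>

lemma lattice_confs:
  assumes "x \<in> confs" "y \<in> confs"
  shows "(\<lambda>n. min (x n) (y n)) \<in> confs" "(\<lambda>n. max (x n) (y n)) \<in> confs"
proof -
  note c = confsD(1-3)[OF assms(1)] confsD(1-3)[OF assms(2)]
  show "(\<lambda>n. min (x n) (y n)) \<in> confs" "(\<lambda>n. max (x n) (y n)) \<in> confs"
    unfolding configs_def mem_Collect_eq
  proof (safe, goal_cases)
    case (1 n) then show ?case by (simp add: c(1,4) min_add_distrib_left)
  next
    case (2 n) then show ?case using c(2,3,5,6)[of n] by (simp add: min_def)
  next
    case (3 n) then show ?case using c(2,3,5,6)[of n] by (simp add: min_def)
  next
    case (4 n) then show ?case by (simp add: c(1,4) max_add_distrib_left)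
  next
    case (5 n) then show ?case using c(2,3,5,6)[of n] by (simp add: max_def)
  next
    case (6 n) then show ?case using c(2,3,5,6)[of n] by (simp add: max_def)
  qed
qed

lemma lattice_action:
  assumes "x \<in> confs" "y \<in> confs"
  shows "action K (\<lambda>n. min (x n) (y n)) + action K (\<lambda>n. max (x n) (y n)) \<le> action K x + action K y"
  unfolding action_def sum.distrib[symmetric]
  by (intro sum_mono link.gen_min_max_le confsD(4) assms)

lemma lattice_action_less:
  assumes "x \<in> confs" "y \<in> confs" "x m < y m" "y (m + 1) < x (m + 1)"
  shows "action K (\<lambda>n. min (x n) (y n)) + action K (\<lambda>n. max (x n) (y n)) < action K x + action K y"
proof -
  note w = lattice_confs[OF assms(1,2)] assms(1,2)
  show ?thesis
    unfolding action_window[OF w(1), of m, symmetric] action_window[OF w(2), of m, symmetric]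
      action_window[OF w(3), of m, symmetric] action_window[OF w(4), of m, symmetric]
      sum.distrib[symmetric]
  proof (rule sum_strict_mono_ex1)
    show "\<forall>n\<in>{m..<m + K}. link.gen n (min (x n) (y n), min (x (n + 1)) (y (n + 1))) +
        link.gen n (max (x n) (y n), max (x (n + 1)) (y (n + 1)))
        \<le> link.gen n (x n, x (n + 1)) + link.gen n (y n, y (n + 1))"
      by (intro ballI link.gen_min_max_le confsD(4) assms)
    show "\<exists>n\<in>{m..<m + K}. link.gen n (min (x n) (y n), min (x (n + 1)) (y (n + 1))) +
        link.gen n (max (x n) (y n), max (x (n + 1)) (y (n + 1)))
        < link.gen n (x n, x (n + 1)) + link.gen n (y n, y (n + 1))"
      using K_ge_2 by (intro bexI[of _ m] link.gen_min_max_less confsD(4) assms) auto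
  qed simp
qed

lemma lattice_minims:
  assumes "x \<in> minims" "y \<in> minims"
  shows "(\<lambda>n. max (x n) (y n)) \<in> minims"
proof -
  have c: "x \<in> confs" "y \<in> confs" using assms by (auto simp: minimizers_def)
  have "action K x \<le> action K (\<lambda>n. min (x n) (y n))"
    using assms(1) lattice_confs[OF c] by (simp add: minimizers_def)
  with lattice_action[OF c] have "action K (\<lambda>n. max (x n) (y n)) \<le> action K y" by linarith
  with assms(2) lattice_confs[OF c] show ?thesis by (fastforce simp: minimizers_def)
qed

lemma minims_no_crossing:
  assumes "x \<in> minims" "y \<in> minims" "x m < y m"
  shows "x (m + 1) \<le> y (m + 1)"
proof (rule ccontr)
  have c: "x \<in> confs" "y \<in> confs" using assms by (auto simp: minimizers_def)
  assume "\<not> ?thesis"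
  then have "action K (\<lambda>n. min (x n) (y n)) + action K (\<lambda>n. max (x n) (y n)) < action K x + action K y"
    using assms by (intro lattice_action_less c) auto
  moreover have "action K x \<le> action K (\<lambda>n. min (x n) (y n))" "action K y \<le> action K (\<lambda>n. max (x n) (y n))"
    using assms(1,2) lattice_confs[OF c] by (simp_all add: minimizers_def)
  ultimately show False by linarith
qed

text \<open>The sequence of points of the plane that realises a given sequence of angles.\<close>

definition graph_orbit :: "(int \<Rightarrow> real) \<Rightarrow> int \<Rightarrow> real \<times> real" where
  "graph_orbit x n = (x n, link.radius n (x n) (x (n + 1)))"

lemma orbit_of_interior_minim:
  assumes x: "x \<in> minims" and "\<And>n. \<rho>m + \<epsilon> < x (n + 1) - x n" "\<And>n. x (n + 1) - x n < \<rho>p - \<epsilon>"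
  shows "orbit (graph_orbit x)"
  unfolding orbit_def
proof
  fix n
  have xc: "x \<in> confs" using x by (simp add: minimizers_def)
  have "link.image_radius n (x n) (x (n + 1)) = link.radius (n + 1) (x (n + 1)) (x (n + 2))"
    using minims_push_down[OF x, of n] minims_push_up[OF x, of n] assms(2,3)[of n] assms(2,3)[of "n + 1"]
    by (simp add: add_ac)
  then show "graph_orbit x (n + 1) = g n (graph_orbit x n)"
    using link.map_radius[OF confsD(4)[OF xc, of n], of n] by (simp add: graph_orbit_def add.assoc)
qed

end

text \<open>For a suitable margin \<open>\<epsilon>\<close> no minimiser touches the walls, see \<open>exists_interior_periodic_problem\<close>.\<close>

locale interior_periodic_problem = periodic_problem +
  assumes interior: "x \<in> minimizers K p \<epsilon> \<Longrightarrow> \<rho>m + \<epsilon> < x (n + 1) - x n \<and> x (n + 1) - x n < \<rho>p - \<epsilon>"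
begin

lemma minims_orbit: "x \<in> minims \<Longrightarrow> orbit (graph_orbit x)"
  using interior by (intro orbit_of_interior_minim) auto

text \<open>If two minimisers \<open>x\<close>, \<open>y\<close> were not ordered, then going from a site with \<open>x < y\<close> to one with \<open>y < x\<close>
they would either cross, which is excluded, or meet at a site preceded by one with \<open>x < y\<close>. In the
second case their maximum is a minimiser, hence an orbit, sharing two consecutive angles with \<open>y\<close>; so
it equals \<open>y\<close>, and \<open>x \<le> y\<close> after all.\<close>

lemma minims_ordered:
  assumes x: "x \<in> minims" and y: "y \<in> minims" and i: "x i < y i"
  shows "x n \<le> y n"
proof (rule ccontr)
  assume n: "\<not> ?thesis"
  have c: "x \<in> confs" "y \<in> confs" using assms by (auto simp: minimizers_def)
  \<comment> \<open>by periodicity the reversed inequality may be assumed to occur to the right of \<open>i\<close>\<close>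
  define k where "k = n + \<bar>i - n\<bar> * K"
  have "\<bar>i - n\<bar> * 1 \<le> \<bar>i - n\<bar> * K" using K_ge_2 by (intro mult_left_mono) auto
  then have "i \<le> k" by (simp add: k_def)
  have k: "y k < x k"
    using n confs_period_mult[OF c(1), of n "\<bar>i - n\<bar>"] confs_period_mult[OF c(2), of n "\<bar>i - n\<bar>"]
    by (simp add: k_def)
  have "\<exists>m. x m < y m \<and> y (m + 1) \<le> x (m + 1)"
  proof (rule ccontr)
    assume none: "\<not> ?thesis"
    have "x k < y k"
      using \<open>i \<le> k\<close> by (induction k rule: int_ge_induct) (use i none in \<open>auto simp: not_le\<close>)
    with k show False by simp
  qed
  then obtain m where m: "x m < y m" "y (m + 1) \<le> x (m + 1)" by blast
  with minims_no_crossing[OF x y m(1)] have eq: "x (m + 1) = y (m + 1)" by simp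
  let ?w = "\<lambda>n. max (x n) (y n)"
  have "graph_orbit ?w = graph_orbit y"
    using m eq by (intro orbit_unique[of _ _ m] minims_orbit lattice_minims x y) (simp add: graph_orbit_def)
  then have "?w k = y k" by (metis fst_conv graph_orbit_def)
  with k show False by simp
qed

end

section \<open>Birkhoff orbits\<close>

context twist_chain
begin

text \<open>The order on all translates \<open>x (n + a N) + b\<close> of the angles is that of the numbers \<open>a \<omega> + b\<close>. This
entails that \<open>\<omega>\<close> is the rotation number under the composition of \<open>N\<close> consecutive maps. With \<open>\<le>\<close> in
the hypothesis, the condition also makes orbits of rational rotation number periodic.\<close>

definition birkhoff :: "real \<Rightarrow> (int \<Rightarrow> real \<times> real) \<Rightarrow> bool" where
  "birkhoff \<omega> z \<longleftrightarrow> orbit z \<and>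
     (\<forall>a b n. 0 \<le> of_int a * \<omega> + of_int b \<longrightarrow> fst (z n) \<le> fst (z (n + a * int N)) + of_int b)"

lemma birkhoff_orbit: "birkhoff \<omega> z \<Longrightarrow> orbit z"
  by (simp add: birkhoff_def)

lemma birkhoffD:
  "birkhoff \<omega> z \<Longrightarrow> 0 \<le> of_int a * \<omega> + of_int b \<Longrightarrow> fst (z n) \<le> fst (z (n + a * int N)) + of_int b"
  by (simp add: birkhoff_def)

end

text \<open>A translate \<open>T x\<close> of a minimiser \<open>x\<close> is a minimiser, hence comparable to \<open>x\<close>. If it were below \<open>x\<close>, so
would be all of \<open>T\<^sup>2 x, T\<^sup>3 x, \<dots>, T\<^sup>q x\<close>, in decreasing order; but \<open>T\<^sup>q x\<close> is \<open>x\<close> shifted by the constant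
\<open>q (a \<omega> + b) \<ge> 0\<close>.\<close>

lemma (in interior_periodic_problem) minims_birkhoff:
  assumes x: "x \<in> minims" and K: "K = q * int N" and q: "0 < q"
  shows "birkhoff (of_int p / of_int q) (graph_orbit x)"
  unfolding birkhoff_def
proof (intro conjI allI impI minims_orbit x)
  fix a b n
  assume ab: "0 \<le> of_int a * (of_int p / of_int q) + real_of_int b"
  let ?T = "\<lambda>n. x (n + a * int N) + of_int b"
  show "fst (graph_orbit x n) \<le> fst (graph_orbit x (n + a * int N)) + of_int b"
  proof (rule ccontr)
    assume "\<not> ?thesis"
    then have less: "?T n < x n" by (simp add: graph_orbit_def)
    have le: "?T m \<le> x m" for m
      by (rule minims_ordered[OF translate_minims[OF x] x less])
    have iter: "x (n + int (Suc j) * (a * int N)) + of_nat (Suc j) * of_int b \<le> ?T n" for j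
    proof (induction j)
      case (Suc j)
      show ?case using Suc le[of "n + int (Suc j) * (a * int N)"] by (simp add: algebra_simps)
    qed simp
    have "0 \<le> of_int q * (of_int a * (of_int p / of_int q) + real_of_int b)"
      using ab q by simp
    also have "\<dots> = of_int (a * p) + of_int q * of_int b" using q by (simp add: field_simps)
    finally have nonneg: "0 \<le> of_int (a * p) + real_of_int q * of_int b" .
    have sq: "Suc (nat q - 1) = nat q" using q by simp
    have "x (n + q * (a * int N)) + of_int q * of_int b \<le> ?T n"
      using iter[of "nat q - 1"] q unfolding sq by simp
    moreover have "x (n + q * (a * int N)) = x n + of_int (a * p)"
      using confs_period_mult[of x n a] x by (simp add: minimizers_def K algebra_simps)
    ultimately show False using less nonneg by simp
  qed
qed

context twist_chain
begin

text \<open>The wall must be thin enough for its heights to exceed \<open>C + K M\<close>, where \<open>C\<close> is a height beyond which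
all steps are \<open>\<delta>\<close>-close to the ends of the strip and \<open>\<delta>\<close> separates these ends from the mean step.\<close>

lemma exists_interior_periodic_problem:
  assumes "int N dvd K" "2 \<le> K" "of_int K * \<rho>m < of_int p" "of_int p < of_int K * \<rho>p"
  shows "\<exists>\<epsilon>. interior_periodic_problem g N \<rho>p \<rho>m K p \<epsilon> \<and> configs K p \<epsilon> \<noteq> {}"
proof -
  define v where "v = real_of_int p / of_int K"
  have v: "of_int K * v = of_int p" using assms(2) by (simp add: v_def)
  have "\<rho>m < v" "v < \<rho>p" using assms by (simp_all add: v_def field_simps)
  define \<delta> where "\<delta> = min (\<rho>p - v) (v - \<rho>m) / 2"
  have \<delta>: "0 < \<delta>" "\<rho>m + \<delta> < v" "v < \<rho>p - \<delta>"
    using \<open>\<rho>m < v\<close> \<open>v < \<rho>p\<close> by (auto simp: \<delta>_def min_def field_simps)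
  obtain M where M: "\<And>n z. \<bar>snd (g n z) - snd z\<bar> \<le> M" using uniform_displacement by blast
  obtain C where C: "\<And>n x r. C \<le> r \<Longrightarrow> \<rho>p - \<delta> < fst (g n (x, r)) - x"
    "\<And>n x r. r \<le> - C \<Longrightarrow> fst (g n (x, r)) - x < \<rho>m + \<delta>" using uniform_step[OF \<delta>(1)] by blast
  obtain \<epsilon>0 where "0 < \<epsilon>0" and e: "\<And>n x y. (x, y) \<in> strip \<Longrightarrow> \<rho>p - \<epsilon>0 \<le> y - x \<Longrightarrow> C + of_int K * M \<le> link.radius n x y"
    "\<And>n x y. (x, y) \<in> strip \<Longrightarrow> y - x \<le> \<rho>m + \<epsilon>0 \<Longrightarrow> link.radius n x y \<le> - (C + of_int K * M)"
    using uniform_radius[of "C + of_int K * M"] by blast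
  define \<epsilon> where "\<epsilon> = min \<delta> \<epsilon>0"
  have \<epsilon>: "0 < \<epsilon>" "\<epsilon> \<le> \<delta>" "\<epsilon> \<le> \<epsilon>0" using \<delta>(1) \<open>0 < \<epsilon>0\<close> by (auto simp: \<epsilon>_def)
  interpret P: periodic_problem g N \<rho>p \<rho>m K p \<epsilon>
    using assms \<epsilon> by unfold_locales auto
  have "interior_periodic_problem g N \<rho>p \<rho>m K p \<epsilon>"
  proof unfold_locales
    fix x n assume x: "x \<in> minimizers K p \<epsilon>"
    have mean: "of_int p < of_int K * (\<rho>p - \<delta>)" "of_int K * (\<rho>m + \<delta>) < of_int p"
      unfolding v[symmetric] using \<delta> assms(2) by (auto intro!: mult_strict_left_mono)
    have "x (n + 1) - x n < \<rho>p - \<epsilon>"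
      using e(1) \<epsilon> \<delta> by (intro P.minims_below_upper_wall[OF x mean(1) _ M C(1)]) auto
    moreover have "\<rho>m + \<epsilon> < x (n + 1) - x n"
      using e(2) \<epsilon> \<delta> by (intro P.minims_above_lower_wall[OF x mean(2) _ M C(2)]) auto
    ultimately show "\<rho>m + \<epsilon> < x (n + 1) - x n \<and> x (n + 1) - x n < \<rho>p - \<epsilon>" by blast
  qed
  moreover have "(\<lambda>n. of_int n * v) \<in> configs K p \<epsilon>"
    using \<delta> \<epsilon> v by (simp add: configs_def algebra_simps)
  ultimately show ?thesis by blast
qed

lemma exists_birkhoff_rational:
  assumes "0 < q" "of_nat N * \<rho>m < of_int p / of_int q" "of_int p / of_int q < of_nat N * \<rho>p"
  shows "\<exists>z. birkhoff (of_int p / of_int q) z"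
proof -
  \<comment> \<open>the fraction is doubled so that two consecutive sites are never identified by periodicity\<close>
  define K where "K = (2 * q) * int N"
  have "1 * 1 \<le> q * int N" using assms(1) N_pos by (intro mult_mono) auto
  then have K: "int N dvd K" "2 \<le> K" by (simp_all add: K_def)
  have "of_int K * \<rho>m < of_int (2 * p)" "of_int (2 * p) < of_int K * \<rho>p"
    using assms by (simp_all add: K_def field_simps)
  from exists_interior_periodic_problem[OF K this] obtain \<epsilon>
    where I: "interior_periodic_problem g N \<rho>p \<rho>m K (2 * p) \<epsilon>" and ne: "configs K (2 * p) \<epsilon> \<noteq> {}" by blast
  interpret I: interior_periodic_problem g N \<rho>p \<rho>m K "2 * p" \<epsilon> by (rule I)
  obtain x where "x \<in> minimizers K (2 * p) \<epsilon>" using I.minims_nonempty[OF ne] by blast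
  from I.minims_birkhoff[OF this K_def] assms(1)
  have "birkhoff (of_int (2 * p) / of_int (2 * q)) (I.graph_orbit x)" by simp
  then show ?thesis by auto
qed

lemma birkhoff_translate:
  assumes "birkhoff \<omega> z"
  shows "birkhoff \<omega> (\<lambda>n. z (n + a * int N) + (of_int b, 0))"
  unfolding birkhoff_def
proof (intro conjI allI impI orbit_translate birkhoff_orbit[OF assms])
  fix c d n assume "0 \<le> of_int c * \<omega> + real_of_int d"
  from birkhoffD[OF assms this, of "n + a * int N"]
  show "fst (z (n + a * int N) + (of_int b, 0)) \<le> fst (z (n + c * int N + a * int N) + (of_int b, 0)) + of_int d"
    by (simp add: add_ac)
qed

lemma birkhoff_deviation:
  assumes "birkhoff \<omega> z"
  shows "fst (z n) + of_int a * \<omega> - 1 \<le> fst (z (n + a * int N))"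
    "fst (z (n + a * int N)) \<le> fst (z n) + of_int a * \<omega> + 1"
proof -
  have "0 \<le> of_int a * \<omega> + of_int \<lceil>- (of_int a * \<omega>)\<rceil>" by linarith
  from birkhoffD[OF assms this, of n] show "fst (z n) + of_int a * \<omega> - 1 \<le> fst (z (n + a * int N))"
    by linarith
  have "0 \<le> of_int (- a) * \<omega> + of_int \<lceil>of_int a * \<omega>\<rceil>" by simp
  from birkhoffD[OF assms this, of "n + a * int N"]
  show "fst (z (n + a * int N)) \<le> fst (z n) + of_int a * \<omega> + 1" by simp linarith
qed

text \<open>If \<open>z n\<close> lies above \<open>C + a N M\<close>, then the next \<open>a N\<close> points lie above \<open>C\<close>, so that each advances by
more than \<open>\<rho>p - \<delta>\<close>. For \<open>a N \<delta> > 1\<close> this exceeds the advance \<open>a \<omega> + 1\<close> permitted by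
\<open>birkhoff_deviation\<close>. Likewise from below.\<close>

lemma birkhoff_bounded:
  assumes "0 < \<delta>"
  shows "\<exists>B. \<forall>\<omega> z n. birkhoff \<omega> z \<longrightarrow> of_nat N * (\<rho>m + 2 * \<delta>) \<le> \<omega> \<longrightarrow> \<omega> \<le> of_nat N * (\<rho>p - 2 * \<delta>) \<longrightarrow>
    \<bar>snd (z n)\<bar> \<le> B"
proof -
  obtain M where "0 \<le> M" and M: "\<And>n z. \<bar>snd (g n z) - snd z\<bar> \<le> M" using uniform_displacement by blast
  obtain C where C: "\<And>n x r. C \<le> r \<Longrightarrow> \<rho>p - \<delta> < fst (g n (x, r)) - x"
    "\<And>n x r. r \<le> - C \<Longrightarrow> fst (g n (x, r)) - x < \<rho>m + \<delta>" using uniform_step[OF assms] by blast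
  obtain a :: nat where "1 / \<delta> < of_nat a" using reals_Archimedean2 by blast
  then have a: "1 < of_nat a * \<delta>" using assms by (simp add: field_simps)
  also have "\<dots> \<le> of_nat a * \<delta> * of_nat N"
    using mult_left_mono[of 1 "of_nat N" "of_nat a * \<delta>"] assms N_pos by simp
  finally have aN: "1 < of_nat (a * N) * \<delta>" by (simp add: mult_ac)
  define B where "B = C + of_nat (a * N) * M"
  have "\<bar>snd (z n)\<bar> \<le> B" if z: "birkhoff \<omega> z" and lo: "of_nat N * (\<rho>m + 2 * \<delta>) \<le> \<omega>"
    and hi: "\<omega> \<le> of_nat N * (\<rho>p - 2 * \<delta>)" for \<omega> z n
  proof -
    have next_z: "z (n + int (Suc j)) = g (n + int j) (z (n + int j))" for j
      using birkhoff_orbit[OF z, unfolded orbit_def, rule_format, of "n + int j"] by (simp add: add.assoc add.commute[of 1])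
    have jM: "of_nat j * M \<le> of_nat (a * N) * M" if "j \<le> a * N" for j
      using that \<open>0 \<le> M\<close> by (intro mult_right_mono) (simp_all del: of_nat_mult)
    have snd_z: "\<bar>snd (z (n + int j)) - snd (z n)\<bar> \<le> of_nat j * M" for j
    proof (induction j)
      case (Suc j)
      then show ?case using M[of "n + int j" "z (n + int j)"] next_z[of j] by (simp add: algebra_simps)
    qed simp
    have "snd (z n) \<le> B"
    proof (rule ccontr)
      assume n: "\<not> ?thesis"
      have "j \<le> a * N \<Longrightarrow> fst (z n) + of_nat j * (\<rho>p - \<delta>) \<le> fst (z (n + int j))" for j
      proof (induction j)
        case (Suc j)
        have "C \<le> snd (z (n + int j))"
          using snd_z[of j] jM[of j] Suc.prems n by (simp add: B_def)
        from C(1)[OF this, of "n + int j" "fst (z (n + int j))"] Suc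
        show ?case unfolding next_z by (simp add: algebra_simps)
      qed simp
      from this[of "a * N"] have "fst (z n) + of_nat (a * N) * (\<rho>p - \<delta>) \<le> fst (z (n + int a * int N))"
        by simp
      also have "\<dots> \<le> fst (z n) + of_nat a * \<omega> + 1"
        using birkhoff_deviation(2)[OF z, of n "int a"] by simp
      also have "of_nat a * \<omega> \<le> of_nat a * (of_nat N * (\<rho>p - 2 * \<delta>))"
        using hi by (intro mult_left_mono) auto
      finally show False using aN by (simp add: algebra_simps)
    qed
    moreover have "- B \<le> snd (z n)"
    proof (rule ccontr)
      assume n: "\<not> ?thesis"
      have "j \<le> a * N \<Longrightarrow> fst (z (n + int j)) \<le> fst (z n) + of_nat j * (\<rho>m + \<delta>)" for j
      proof (induction j)
        case (Suc j)
        have "snd (z (n + int j)) \<le> - C"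
          using snd_z[of j] jM[of j] Suc.prems n by (simp add: B_def)
        from C(2)[OF this, of "n + int j" "fst (z (n + int j))"] Suc
        show ?case unfolding next_z by (simp add: algebra_simps)
      qed simp
      from this[of "a * N"] have "fst (z (n + int a * int N)) \<le> fst (z n) + of_nat (a * N) * (\<rho>m + \<delta>)"
        by simp
      moreover have "fst (z n) + of_nat a * \<omega> - 1 \<le> fst (z (n + int a * int N))"
        using birkhoff_deviation(1)[OF z, of n "int a"] by simp
      moreover have "of_nat a * (of_nat N * (\<rho>m + 2 * \<delta>)) \<le> of_nat a * \<omega>"
        using lo by (intro mult_left_mono) auto
      ultimately show False using aN by (simp add: algebra_simps)
    qed
    ultimately show ?thesis by simp
  qed
  then show ?thesis by blast
qed

text \<open>As each map and its inverse are continuous, convergence at time \<open>0\<close> propagates to all times.\<close>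

lemma orbit_limit:
  assumes orbits: "\<And>k. orbit (Z k)" and lim: "(\<lambda>k. Z k 0) \<longlonglongrightarrow> l"
  shows "\<exists>z. orbit z \<and> (\<forall>n. (\<lambda>k. Z k n) \<longlonglongrightarrow> z n)"
proof -
  have "\<exists>l. (\<lambda>k. Z k n) \<longlonglongrightarrow> l" for n
  proof (induction n rule: int_induct[where k = 0])
    case base
    show ?case using lim by blast
  next
    case (step1 i)
    then obtain l where "(\<lambda>k. Z k i) \<longlonglongrightarrow> l" by blast
    then have "(\<lambda>k. g i (Z k i)) \<longlonglongrightarrow> g i l"
      by (rule continuous_on_tendsto_compose[OF link.continuous_map]) auto
    moreover have "g i (Z k i) = Z k (i + 1)" for k
      using orbits[of k] by (simp add: orbit_def)
    ultimately show ?case by (intro exI) simp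
  next
    case (step2 i)
    then obtain l where "(\<lambda>k. Z k i) \<longlonglongrightarrow> l" by blast
    then have "(\<lambda>k. inv (g (i - 1)) (Z k i)) \<longlonglongrightarrow> inv (g (i - 1)) l"
      by (rule continuous_on_tendsto_compose[OF link.continuous_inv]) auto
    moreover have "inv (g (i - 1)) (Z k i) = Z k (i - 1)" for k
      using orbits[of k] inv_f_f[OF bij_is_inj[OF link.bij]] by (metis orbit_def diff_add_cancel)
    ultimately show ?case by (intro exI) simp
  qed
  then obtain z where z: "\<And>n. (\<lambda>k. Z k n) \<longlonglongrightarrow> z n" by metis
  have "z (n + 1) = g n (z n)" for n
  proof (rule LIMSEQ_unique[OF z])
    have "(\<lambda>k. g n (Z k n)) \<longlonglongrightarrow> g n (z n)"
      by (rule continuous_on_tendsto_compose[OF link.continuous_map z]) auto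
    then show "(\<lambda>k. Z k (n + 1)) \<longlonglongrightarrow> g n (z n)" using orbits by (simp add: orbit_def)
  qed
  with z show ?thesis by (auto simp: orbit_def)
qed

lemma normalize_birkhoff:
  assumes "birkhoff \<omega> z"
  shows "\<exists>z'. birkhoff \<omega> z' \<and> fst (z' 0) \<in> {0..1}"
proof (intro exI conjI)
  let ?z = "\<lambda>n. z (n + 0 * int N) + (of_int (- \<lfloor>fst (z 0)\<rfloor>), 0)"
  show "birkhoff \<omega> ?z" by (rule birkhoff_translate[OF assms])
  have "fst (?z 0) = frac (fst (z 0))" by (simp add: frac_def)
  then show "fst (?z 0) \<in> {0..1}" using frac_ge_0[of "fst (z 0)"] frac_lt_1[of "fst (z 0)"] by simp
qed

lemma gap_around:
  assumes "of_nat N * \<rho>m < \<omega>" "\<omega> < of_nat N * \<rho>p"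
  obtains \<delta> where "0 < \<delta>" "of_nat N * (\<rho>m + 2 * \<delta>) < \<omega>" "\<omega> < of_nat N * (\<rho>p - 2 * \<delta>)"
proof -
  let ?v = "\<omega> / of_nat N"
  have v: "\<rho>m < ?v" "?v < \<rho>p" using assms N_pos by (simp_all add: field_simps)
  obtain d where d: "0 < d" "d < \<rho>p - ?v" "d < ?v - \<rho>m"
    using field_lbound_gt_zero[of "\<rho>p - ?v" "?v - \<rho>m"] v by auto
  then have "\<rho>m + 2 * (d / 2) < ?v" "?v < \<rho>p - 2 * (d / 2)" by simp_all
  with d(1) show thesis using N_pos by (intro that[of "d / 2"]) (simp_all add: field_simps)
qed

text \<open>For irrational \<open>\<omega>\<close>, Birkhoff orbits with rational rotation numbers close to \<open>\<omega>\<close> start, up to integer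
translation, in a fixed compact set. The order relations pass to the limit: \<open>a \<omega> + b > 0\<close> holds for
nearby rotation numbers as well, and \<open>a \<omega> + b = 0\<close> occurs for \<open>a = b = 0\<close> only.\<close>

theorem exists_birkhoff:
  assumes \<omega>: "of_nat N * \<rho>m < \<omega>" "\<omega> < of_nat N * \<rho>p"
  shows "\<exists>z. birkhoff \<omega> z"
proof (cases "\<omega> \<in> \<rat>")
  case True
  then obtain p q where "0 < q" "\<omega> = of_int p / of_int q" by (rule Rats_cases')
  then show ?thesis using exists_birkhoff_rational[of q p] \<omega> by auto
next
  case irr: False
  obtain \<delta> where \<delta>: "0 < \<delta>" "of_nat N * (\<rho>m + 2 * \<delta>) < \<omega>" "\<omega> < of_nat N * (\<rho>p - 2 * \<delta>)"
    using gap_around[OF \<omega>] by blast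
  obtain B where B: "\<And>\<omega> z n. birkhoff \<omega> z \<Longrightarrow> of_nat N * (\<rho>m + 2 * \<delta>) \<le> \<omega> \<Longrightarrow>
      \<omega> \<le> of_nat N * (\<rho>p - 2 * \<delta>) \<Longrightarrow> \<bar>snd (z n)\<bar> \<le> B"
    using birkhoff_bounded[OF \<delta>(1)] by blast
  have "\<exists>w\<in>\<rat>. \<omega> < w \<and> w < min (\<omega> + 1 / of_nat (Suc k)) (of_nat N * (\<rho>p - 2 * \<delta>))" for k
    using \<delta> by (intro Rats_dense_in_real) simp
  then obtain w where w: "\<And>k. w k \<in> \<rat>" "\<And>k. \<omega> < w k"
    "\<And>k. w k < min (\<omega> + 1 / of_nat (Suc k)) (of_nat N * (\<rho>p - 2 * \<delta>))" by metis
  have w_lim: "w \<longlonglongrightarrow> \<omega>"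
  proof (rule tendsto_sandwich[of "\<lambda>_. \<omega>" _ _ "\<lambda>k. \<omega> + 1 / of_nat (Suc k)"])
    show "(\<lambda>k. \<omega> + 1 / of_nat (Suc k)) \<longlonglongrightarrow> \<omega>"
      using tendsto_add[OF tendsto_const[of \<omega>] LIMSEQ_inverse_real_of_nat] by (simp add: inverse_eq_divide)
  qed (use w in \<open>auto intro!: always_eventually less_imp_le\<close>)
  have "\<exists>z. birkhoff (w k) z \<and> fst (z 0) \<in> {0..1}" for k
  proof -
    obtain p q where "0 < q" and pq: "w k = of_int p / of_int q" using w(1) by (rule Rats_cases')
    moreover have "of_nat N * (\<rho>p - 2 * \<delta>) \<le> of_nat N * \<rho>p" using \<delta>(1) by (intro mult_left_mono) auto
    ultimately have "\<exists>z. birkhoff (w k) z"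
      using w(2,3)[of k] \<omega> unfolding pq by (intro exists_birkhoff_rational) auto
    then show ?thesis using normalize_birkhoff by blast
  qed
  then obtain Z where Z: "\<And>k. birkhoff (w k) (Z k)" "\<And>k. fst (Z k 0) \<in> {0..1}" by metis
  have "\<bar>snd (Z k 0)\<bar> \<le> B" for k
    using w(2,3)[of k] \<delta> by (intro B[OF Z(1)]) auto
  then have "Z k 0 \<in> {0..1} \<times> {- B..B}" for k
    using Z(2)[of k] by (auto simp: mem_Times_iff abs_le_iff minus_le_iff)
  then obtain l s where "strict_mono (s :: nat \<Rightarrow> nat)" and l: "((\<lambda>k. Z k 0) \<circ> s) \<longlonglongrightarrow> l"
    using seq_compactE[OF compact_imp_seq_compact[OF compact_Times[OF compact_Icc compact_Icc]],
        of "\<lambda>k. Z k 0" 0 1 "- B" B] by blast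
  have "orbit (Z (s k))" for k using birkhoff_orbit[OF Z(1)] .
  from orbit_limit[OF this l[unfolded o_def]]
  obtain z where z: "orbit z" "\<And>n. (\<lambda>k. Z (s k) n) \<longlonglongrightarrow> z n" by blast
  have "birkhoff \<omega> z"
    unfolding birkhoff_def
  proof (intro conjI allI impI z(1))
    fix a b n assume ab: "0 \<le> of_int a * \<omega> + real_of_int b"
    show "fst (z n) \<le> fst (z (n + a * int N)) + of_int b"
    proof (cases "of_int a * \<omega> + real_of_int b = 0")
      case True
      have "a = 0"
      proof (rule ccontr)
        assume "a \<noteq> 0"
        with True have "\<omega> = - of_int b / of_int a" by (simp add: field_simps)
        also have "\<dots> \<in> \<rat>" by simp
        finally show False using irr by simp
      qed
      with True show ?thesis by simp
    next
      case False
      with ab have pos: "0 < of_int a * \<omega> + real_of_int b" by simp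
      have "(\<lambda>k. of_int a * w (s k) + of_int b) \<longlonglongrightarrow> of_int a * \<omega> + of_int b"
        using LIMSEQ_subseq_LIMSEQ[OF w_lim \<open>strict_mono s\<close>] by (auto intro!: tendsto_intros simp: o_def)
      from order_tendstoD(1)[OF this pos]
      have "eventually (\<lambda>k. fst (Z (s k) n) \<le> fst (Z (s k) (n + a * int N)) + of_int b) sequentially"
        by eventually_elim (auto intro: birkhoffD[OF Z(1)])
      then show ?thesis
        by (rule tendsto_le[OF sequentially_bot, rotated 2])
           (auto intro!: tendsto_intros z(2))
    qed
  qed
  then show ?thesis by blast
qed

end

section \<open>Hull functions of a Birkhoff orbit\<close>

context twist_chain
begin

lemma orbit_snd_unique:
  assumes "orbit z" "orbit z'" "\<And>n. fst (z n) = fst (z' n)"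
  shows "z = z'"
proof
  fix n
  have "fst (g n (z n)) = fst (g n (z' n))"
    using assms(1,2) assms(3)[of "n + 1"] by (simp add: orbit_def)
  then have "fst (g n (fst (z n), snd (z n))) = fst (g n (fst (z n), snd (z' n)))"
    by (metis assms(3) prod.collapse)
  then have "snd (z n) = snd (z' n)" by (rule link.angle_eq_iff[THEN iffD1])
  then show "z n = z' n" using assms(3)[of n] by (simp add: prod_eq_iff)
qed

text \<open>At a common angle, the order of the next angles gives \<open>r \<le> r'\<close> by the twist condition, while the order
of the previous angles gives \<open>r' \<le> r\<close>, because the height of the image decreases in the initial
angle. So the two orbits pass through the same point.\<close>

lemma ordered_orbits_touch:
  assumes z: "orbit z" and z': "orbit z'" and le: "\<And>n. fst (z n) \<le> fst (z' n)" and touch: "fst (z m) = fst (z' m)"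
  shows "z = z'"
proof -
  have zm: "z (m + 1) = g m (fst (z m), snd (z m))" "z' (m + 1) = g m (fst (z m), snd (z' m))"
    using z z' touch unfolding orbit_def by (metis prod.collapse)+
  have "\<not> snd (z' m) < snd (z m)"
    using le[of "m + 1"] link.angle_strict_mono[of "snd (z' m)" "snd (z m)" m "fst (z m)"]
    unfolding zm by linarith
  moreover have "snd (z' m) \<le> snd (z m)"
  proof -
    have prev: "link.radius (m - 1) (fst (w (m - 1))) (fst (w m)) = snd (w (m - 1))"
      "link.image_radius (m - 1) (fst (w (m - 1))) (fst (w m)) = snd (w m)"
      "(fst (w (m - 1)), fst (w m)) \<in> strip" if "orbit w" for w
    proof -
      have w: "w m = g (m - 1) (fst (w (m - 1)), snd (w (m - 1)))"
        using that by (metis orbit_def diff_add_cancel prod.collapse)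
      show 1: "link.radius (m - 1) (fst (w (m - 1))) (fst (w m)) = snd (w (m - 1))"
        unfolding w by (rule link.radius_unique)
      show "link.image_radius (m - 1) (fst (w (m - 1))) (fst (w m)) = snd (w m)"
        unfolding link.image_radius_def 1 using w by simp
      show "(fst (w (m - 1)), fst (w m)) \<in> strip"
        unfolding w by (rule link.angle_in_strip)
    qed
    show ?thesis
      using link.image_radius_antimono[OF le[of "m - 1"], of "fst (z m)" "m - 1"] prev[OF z] prev[OF z'] touch
      by simp
  qed
  ultimately have "z m = z' m" using touch by (simp add: prod_eq_iff)
  then show ?thesis by (rule orbit_unique[OF z z'])
qed

text \<open>Otherwise the orbit touches one of its translates \<open>T z\<close> that lies above it, hence \<open>T z = z\<close>. Then also
\<open>T\<^sup>j z = z\<close>, whereas for \<open>j (a \<omega> + b) > 1\<close> the Birkhoff property puts \<open>T\<^sup>j z\<close> at least one full turn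
ahead of \<open>z\<close>.\<close>

lemma birkhoff_strict:
  assumes z: "birkhoff \<omega> z" and pos: "0 < of_int a * \<omega> + of_int b"
  shows "fst (z n) < fst (z (n + a * int N)) + of_int b"
proof (rule ccontr)
  let ?T = "\<lambda>n. z (n + a * int N) + (of_int b, 0)"
  assume "\<not> ?thesis"
  then have "fst (z n) = fst (?T n)" using birkhoffD[OF z, of a b n] pos by simp
  moreover have "fst (z m) \<le> fst (?T m)" for m using birkhoffD[OF z, of a b m] pos by simp
  ultimately have T: "z = ?T"
    using ordered_orbits_touch[OF birkhoff_orbit[OF z] orbit_translate[OF birkhoff_orbit[OF z]]] by blast
  have iter: "z (n + int j * (a * int N)) + (of_nat j * of_int b, 0) = z n" for j
  proof (induction j)
    case 0
    show ?case by (simp flip: zero_prod_def)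
  next
    case (Suc j)
    have "z (n + int j * (a * int N)) = z (n + int (Suc j) * (a * int N)) + (of_int b, 0)"
      using fun_cong[OF T, of "n + int j * (a * int N)"] by (simp add: algebra_simps)
    with Suc show ?case by (simp add: prod_eq_iff algebra_simps)
  qed
  obtain j :: nat where "1 / (of_int a * \<omega> + of_int b) < of_nat j" using reals_Archimedean2 by blast
  then have "1 < of_nat j * (of_int a * \<omega> + of_int b)" using pos by (simp add: field_simps)
  then have "0 \<le> of_int (int j * a) * \<omega> + of_int (int j * b - 1)" by (simp add: algebra_simps)
  from birkhoffD[OF z this, of n] have "fst (z n) \<le> fst (z (n + int j * (a * int N)) + (of_nat j * of_int b, 0)) - 1"
    by (simp add: algebra_simps)
  then show False unfolding iter by simp
qed

end

definition approximants :: "real \<Rightarrow> real \<Rightarrow> (int \<times> int) set" where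
  "approximants \<omega> t = {(a, b). of_int a * \<omega> + of_int b \<le> t}"

text \<open>Along such a sequence the angles of the translated orbits converge to their suprema at all times
simultaneously, which is needed for the limit to be an orbit.\<close>

lemma cofinal_sequence:
  "\<exists>s :: nat \<Rightarrow> int \<times> int. (\<forall>j. s j \<in> approximants \<omega> t) \<and>
    (\<forall>(a, b) \<in> approximants \<omega> t. eventually (\<lambda>j. of_int a * \<omega> + of_int b \<le>
       of_int (fst (s j)) * \<omega> + of_int (snd (s j))) sequentially)"
proof -
  define v where "v c = of_int (fst c) * \<omega> + of_int (snd c)" for c :: "int \<times> int"
  let ?D = "approximants \<omega> t"
  have D: "c \<in> ?D \<longleftrightarrow> v c \<le> t" for c by (cases c) (simp add: approximants_def v_def)
  have "(0, \<lfloor>t\<rfloor>) \<in> ?D" by (simp add: approximants_def)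
  then have ne: "v ` ?D \<noteq> {}" by blast
  have bdd: "bdd_above (v ` ?D)" by (rule bdd_aboveI[of _ t]) (auto simp: D)
  have "\<exists>s. (\<forall>j. s j \<in> ?D) \<and> (\<forall>c\<in>?D. eventually (\<lambda>j. v c \<le> v (s j)) sequentially)"
  proof (cases "\<exists>m\<in>?D. \<forall>c\<in>?D. v c \<le> v m")
    case True
    then obtain m where "m \<in> ?D" "\<forall>c\<in>?D. v c \<le> v m" by blast
    then show ?thesis by (intro exI[of _ "\<lambda>_. m"]) simp
  next
    case False
    define \<sigma> where "\<sigma> = Sup (v ` ?D)"
    have le: "v c \<le> \<sigma>" if "c \<in> ?D" for c
      unfolding \<sigma>_def using that by (intro cSup_upper bdd) simp
    have less: "v c < \<sigma>" if c: "c \<in> ?D" for c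
    proof -
      obtain d where "d \<in> ?D" "v c < v d" using False c by force
      then show ?thesis using le[of d] by simp
    qed
    have "\<exists>c\<in>?D. \<sigma> - 1 / of_nat (Suc j) < v c" for j
      using less_cSupD[OF ne, of "\<sigma> - 1 / of_nat (Suc j)"] unfolding \<sigma>_def by simp
    then obtain s where s: "\<And>j. s j \<in> ?D" "\<And>j. \<sigma> - 1 / of_nat (Suc j) < v (s j)" by metis
    have "eventually (\<lambda>j. v c \<le> v (s j)) sequentially" if "c \<in> ?D" for c
    proof -
      have "(\<lambda>j. \<sigma> - 1 / of_nat (Suc j)) \<longlonglongrightarrow> \<sigma>"
        using tendsto_diff[OF tendsto_const[of \<sigma>] LIMSEQ_inverse_real_of_nat] by (simp add: inverse_eq_divide)
      from order_tendstoD(1)[OF this less[OF that]] show ?thesis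
        by eventually_elim (use s(2) in \<open>auto intro: less_imp_le less_trans\<close>)
    qed
    with s(1) show ?thesis by blast
  qed
  then show ?thesis by (simp add: v_def case_prod_beta)
qed

lemma two_approximants_between:
  fixes s t :: real
  assumes "\<omega> \<notin> \<rat>" "s < t"
  shows "\<exists>a b c d. s < of_int a * \<omega> + of_int b \<and> of_int a * \<omega> + of_int b < of_int c * \<omega> + of_int d \<and>
     of_int c * \<omega> + of_int d < t"
proof -
  have "0 < (t - s) / 6" using assms(2) by simp
  from sequence_of_fractional_parts_is_dense[OF assms(1) this, of "s + (t - s) / 3"]
  obtain b a where 1: "\<bar>of_int a * \<omega> - of_int b - (s + (t - s) / 3)\<bar> < (t - s) / 6" by blast
  from sequence_of_fractional_parts_is_dense[OF assms(1) \<open>0 < (t - s) / 6\<close>, of "s + 2 * (t - s) / 3"]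
  obtain d c where 2: "\<bar>of_int c * \<omega> - of_int d - (s + 2 * (t - s) / 3)\<bar> < (t - s) / 6" by blast
  have "s < of_int a * \<omega> + of_int (- b)" "of_int a * \<omega> + of_int (- b) < of_int c * \<omega> + of_int (- d)"
    "of_int c * \<omega> + of_int (- d) < t"
    using 1 2 assms(2) by (simp_all add: abs_less_iff) argo+
  then show ?thesis by blast
qed

lemma locally_bounded_variation_monotone:
  assumes "mono p" "mono q"
    and lip: "\<And>s t. \<bar>f s - f t\<bar> \<le> K * (\<bar>p s - p t\<bar> + \<bar>q s - q t\<bar>)" and "0 \<le> K"
  shows "locally_bounded_variation f"
  unfolding locally_bounded_variation_def bounded_variation_on_def
proof (intro allI)
  fix a b :: real
  show "\<exists>C. \<forall>(n::nat) t. (\<forall>i\<le>n. t i \<in> {a..b}) \<and> (\<forall>i<n. t i \<le> t (Suc i)) \<longrightarrow>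
     (\<Sum>i<n. \<bar>f (t (Suc i)) - f (t i)\<bar>) \<le> C"
  proof (intro exI allI impI)
    fix n :: nat and t :: "nat \<Rightarrow> real"
    assume t: "(\<forall>i\<le>n. t i \<in> {a..b}) \<and> (\<forall>i<n. t i \<le> t (Suc i))"
    have "(\<Sum>i<n. \<bar>f (t (Suc i)) - f (t i)\<bar>) \<le>
        (\<Sum>i<n. K * ((p (t (Suc i)) - p (t i)) + (q (t (Suc i)) - q (t i))))"
    proof (rule sum_mono)
      fix i assume "i \<in> {..<n}"
      then have "t i \<le> t (Suc i)" using t by simp
      then have "p (t i) \<le> p (t (Suc i))" "q (t i) \<le> q (t (Suc i))" using assms(1,2) by (auto dest: monoD)
      then show "\<bar>f (t (Suc i)) - f (t i)\<bar> \<le> K * ((p (t (Suc i)) - p (t i)) + (q (t (Suc i)) - q (t i)))"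
        using lip[of "t (Suc i)" "t i"] by simp
    qed
    also have "\<dots> = K * ((p (t n) - p (t 0)) + (q (t n) - q (t 0)))"
      unfolding sum_distrib_left[symmetric] sum.distrib
      using sum_lessThan_telescope[of "\<lambda>i. p (t i)" n] sum_lessThan_telescope[of "\<lambda>i. q (t i)" n] by simp
    also have "\<dots> \<le> K * ((p b - p a) + (q b - q a))"
    proof -
      have "a \<le> t 0" "t n \<le> b" using t by auto
      then have "p (t n) \<le> p b" "p a \<le> p (t 0)" "q (t n) \<le> q b" "q a \<le> q (t 0)"
        using assms(1,2) by (auto dest: monoD)
      then show ?thesis using \<open>0 \<le> K\<close> by (intro mult_left_mono) auto
    qed
    finally show "(\<Sum>i<n. \<bar>f (t (Suc i)) - f (t i)\<bar>) \<le> K * ((p b - p a) + (q b - q a))" .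
  qed
qed

text \<open>A Birkhoff orbit together with a bound for its heights, as provided by \<open>birkhoff_bounded\<close>.\<close>

locale bounded_birkhoff = twist_chain +
  fixes \<omega> B :: real and z :: "int \<Rightarrow> real \<times> real"
  assumes birkhoff: "birkhoff \<omega> z" and bounded: "\<bar>snd (z n)\<bar> \<le> B"
begin

definition translate :: "int \<times> int \<Rightarrow> int \<Rightarrow> real \<times> real" where
  "translate c n = z (n + fst c * int N) + (of_int (snd c), 0)"

text \<open>Known as the hull function of the orbit: it parametrises the angles at time \<open>n\<close> of the translates,
and of limits of translates, by the phase \<open>t\<close>.\<close>

definition angle_hull :: "int \<Rightarrow> real \<Rightarrow> real" where
  "angle_hull n t = (SUP c \<in> approximants \<omega> t. fst (translate c n))"

lemma translate_mono:
  assumes "of_int (fst c) * \<omega> + of_int (snd c) \<le> of_int (fst d) * \<omega> + of_int (snd d)"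
  shows "fst (translate c n) \<le> fst (translate d n)"
proof -
  have "0 \<le> of_int (fst d - fst c) * \<omega> + of_int (snd d - snd c)"
    using assms by (simp add: algebra_simps)
  from birkhoffD[OF birkhoff this, of "n + fst c * int N"] show ?thesis
    by (simp add: translate_def algebra_simps)
qed

lemma approximants_nonempty: "approximants \<omega> t \<noteq> {}"
proof -
  have "(0, \<lfloor>t\<rfloor>) \<in> approximants \<omega> t" by (simp add: approximants_def)
  then show ?thesis by blast
qed

lemma translate_bdd_above: "bdd_above ((\<lambda>c. fst (translate c n)) ` approximants \<omega> t)"
proof (rule bdd_aboveI)
  fix y assume "y \<in> (\<lambda>c. fst (translate c n)) ` approximants \<omega> t"
  then obtain c where c: "c \<in> approximants \<omega> t" "y = fst (translate c n)" by blast
  then have "of_int (fst c) * \<omega> + of_int (snd c) \<le> t" by (auto simp: approximants_def)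
  then have "of_int (fst c) * \<omega> + of_int (snd c) \<le> of_int (fst (0, \<lceil>t\<rceil>)) * \<omega> + of_int (snd (0::int, \<lceil>t\<rceil>))"
    by simp linarith
  then show "y \<le> fst (translate (0, \<lceil>t\<rceil>) n)" unfolding c(2) by (rule translate_mono)
qed

lemma translate_le_hull: "of_int a * \<omega> + of_int b \<le> t \<Longrightarrow> fst (translate (a, b) n) \<le> angle_hull n t"
  unfolding angle_hull_def by (intro cSUP_upper translate_bdd_above) (simp add: approximants_def)

lemma hull_le_translate: "t \<le> of_int a * \<omega> + of_int b \<Longrightarrow> angle_hull n t \<le> fst (translate (a, b) n)"
  unfolding angle_hull_def by (intro cSUP_least approximants_nonempty translate_mono) (auto simp: approximants_def)

lemma hull_mono: "mono (angle_hull n)"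
  unfolding angle_hull_def
  by (intro monoI cSUP_subset_mono approximants_nonempty translate_bdd_above) (auto simp: approximants_def)

lemma hull_shift: "angle_hull n (t + of_int a * \<omega> + of_int b) = angle_hull (n + a * int N) t + of_int b"
proof -
  let ?s = "\<lambda>c. (fst c + a, snd c + b) :: int \<times> int"
  have "approximants \<omega> (t + of_int a * \<omega> + of_int b) = ?s ` approximants \<omega> t"
  proof (rule set_eqI)
    fix c :: "int \<times> int"
    have "c \<in> approximants \<omega> (t + of_int a * \<omega> + of_int b) \<longleftrightarrow> (fst c - a, snd c - b) \<in> approximants \<omega> t"
      by (cases c) (simp add: approximants_def algebra_simps)
    also have "\<dots> \<longleftrightarrow> c \<in> ?s ` approximants \<omega> t" by (force simp: image_iff)
    finally show "c \<in> approximants \<omega> (t + of_int a * \<omega> + of_int b) \<longleftrightarrow> c \<in> ?s ` approximants \<omega> t" .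
  qed
  then have "angle_hull n (t + of_int a * \<omega> + of_int b) = (SUP c \<in> approximants \<omega> t. fst (translate (?s c) n))"
    by (simp add: angle_hull_def image_image)
  also have "\<dots> = (SUP c \<in> approximants \<omega> t. of_int b + fst (translate c (n + a * int N)))"
    by (simp add: translate_def algebra_simps)
  also have "\<dots> = of_int b + angle_hull (n + a * int N) t"
    unfolding angle_hull_def
    using continuous_at_Sup_mono[of "\<lambda>y. of_int b + y" "(\<lambda>c. fst (translate c (n + a * int N))) ` approximants \<omega> t"]
      approximants_nonempty[of t] translate_bdd_above[of "n + a * int N" t]
    by (simp add: image_image mono_def continuous_add continuous_const continuous_ident)
  finally show ?thesis by simp
qed

text \<open>The translates along a cofinal sequence converge in angle, and their heights are bounded, so a
subsequence converges to an orbit.\<close>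

lemma orbit_on_hull:
  "\<exists>w. orbit w \<and> (\<forall>n. fst (w n) = angle_hull n t) \<and> (\<forall>n. \<bar>snd (w n)\<bar> \<le> B)"
proof -
  obtain s where s: "\<And>j. s j \<in> approximants \<omega> t"
    and cofinal: "\<And>c. c \<in> approximants \<omega> t \<Longrightarrow> eventually (\<lambda>j. of_int (fst c) * \<omega> + of_int (snd c) \<le>
       of_int (fst (s j)) * \<omega> + of_int (snd (s j))) sequentially"
    using cofinal_sequence[of \<omega> t] by (auto simp: case_prod_beta)
  have lim: "(\<lambda>j. fst (translate (s j) n)) \<longlonglongrightarrow> angle_hull n t" for n
  proof (rule order_tendstoI)
    fix y assume "y < angle_hull n t"
    then obtain c where c: "c \<in> approximants \<omega> t" "y < fst (translate c n)"
      unfolding angle_hull_def less_cSUP_iff[OF approximants_nonempty translate_bdd_above] by blast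
    show "eventually (\<lambda>j. y < fst (translate (s j) n)) sequentially"
      using cofinal[OF c(1)]
    proof eventually_elim
      case (elim j)
      from c(2) translate_mono[OF elim, of n] show ?case by (rule less_le_trans)
    qed
  next
    fix y assume "angle_hull n t < y"
    moreover have "fst (translate (s j) n) \<le> angle_hull n t" for j
      using s[of j] by (cases "s j") (auto simp: approximants_def intro: translate_le_hull)
    ultimately show "eventually (\<lambda>j. fst (translate (s j) n) < y) sequentially"
      by (intro always_eventually) (metis le_less_trans)
  qed
  have snd_bound: "\<bar>snd (translate c n)\<bar> \<le> B" for c n using bounded by (simp add: translate_def)
  have "bounded (range (\<lambda>j. translate (s j) 0))"
  proof (rule bounded_subset)
    show "bounded (range (\<lambda>j. fst (translate (s j) 0)) \<times> {- B..B})"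
      using convergent_imp_bounded[OF lim[of 0]] by (intro bounded_Times) auto
    show "range (\<lambda>j. translate (s j) 0) \<subseteq> range (\<lambda>j. fst (translate (s j) 0)) \<times> {- B..B}"
    proof (rule image_subsetI)
      fix j
      show "translate (s j) 0 \<in> range (\<lambda>j. fst (translate (s j) 0)) \<times> {- B..B}"
        using snd_bound[of "s j" 0] by (simp add: mem_Times_iff abs_le_iff minus_le_iff)
    qed
  qed
  then obtain l r where r: "strict_mono (r :: nat \<Rightarrow> nat)" and l: "((\<lambda>j. translate (s j) 0) \<circ> r) \<longlonglongrightarrow> l"
    using bounded_imp_convergent_subsequence by blast
  have "orbit (translate (s (r j)))" for j
    unfolding translate_def by (rule orbit_translate[OF birkhoff_orbit[OF birkhoff]])
  from orbit_limit[OF this l[unfolded o_def]] obtain w where w: "orbit w"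
    "\<And>n. (\<lambda>j. translate (s (r j)) n) \<longlonglongrightarrow> w n" by blast
  have "fst (w n) = angle_hull n t" for n
    using tendsto_fst[OF w(2)] LIMSEQ_subseq_LIMSEQ[OF lim r, unfolded o_def] by (rule LIMSEQ_unique)
  moreover have "\<bar>snd (w n)\<bar> \<le> B" for n
    by (rule tendsto_upperbound[OF tendsto_rabs[OF tendsto_snd[OF w(2)]]]) (simp_all add: snd_bound)
  ultimately show ?thesis using w(1) by blast
qed

definition hull_orbit :: "real \<Rightarrow> int \<Rightarrow> real \<times> real" where
  "hull_orbit t = (SOME w. orbit w \<and> (\<forall>n. fst (w n) = angle_hull n t) \<and> (\<forall>n. \<bar>snd (w n)\<bar> \<le> B))"

lemma hull_orbit:
  "orbit (hull_orbit t)" "fst (hull_orbit t n) = angle_hull n t" "\<bar>snd (hull_orbit t n)\<bar> \<le> B"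
proof -
  have "orbit (hull_orbit t) \<and> (\<forall>n. fst (hull_orbit t n) = angle_hull n t) \<and> (\<forall>n. \<bar>snd (hull_orbit t n)\<bar> \<le> B)"
    unfolding hull_orbit_def by (rule someI_ex[OF orbit_on_hull])
  then show "orbit (hull_orbit t)" "fst (hull_orbit t n) = angle_hull n t" "\<bar>snd (hull_orbit t n)\<bar> \<le> B"
    by simp_all
qed

text \<open>This contains both the periodicity and the conjugacy equation: an orbit is determined by its angles,
and these transform as stated because \<open>a \<omega> + b \<le> t\<close> is preserved by shifting \<open>(a, b)\<close> together
with \<open>t\<close>.\<close>

lemma hull_orbit_shift:
  "hull_orbit (t + of_int a * \<omega> + of_int b) = (\<lambda>n. hull_orbit t (n + a * int N) + (of_int b, 0))"
  by (intro orbit_snd_unique orbit_translate hull_orbit(1)) (simp add: hull_orbit(2) hull_shift)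

lemma hull_strict_mono:
  assumes "\<omega> \<notin> \<rat>"
  shows "strict_mono (angle_hull n)"
proof (rule strict_monoI)
  fix s t :: real assume "s < t"
  then obtain a b c d where abcd: "s < of_int a * \<omega> + of_int b"
    "of_int a * \<omega> + of_int b < of_int c * \<omega> + of_int d" "of_int c * \<omega> + of_int d < t"
    using two_approximants_between[OF assms] by blast
  have "angle_hull n s \<le> fst (translate (a, b) n)" using abcd by (intro hull_le_translate) simp
  also have "\<dots> < fst (translate (c, d) n)"
  proof -
    have "0 < of_int (c - a) * \<omega> + of_int (d - b)" using abcd by (simp add: algebra_simps)
    from birkhoff_strict[OF birkhoff this, of "n + a * int N"] show ?thesis
      by (simp add: translate_def algebra_simps)
  qed
  also have "\<dots> \<le> angle_hull n t" using abcd by (intro translate_le_hull) simp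
  finally show "angle_hull n s < angle_hull n t" .
qed

text \<open>The height at time \<open>0\<close> is a Lipschitz function of the angles at times \<open>0\<close> and \<open>1\<close>, which are both monotone
in \<open>t\<close>.\<close>

lemma radius_bounded_variation: "locally_bounded_variation (\<lambda>t. snd (hull_orbit t 0))"
proof -
  obtain K where "0 \<le> K" and K: "\<And>x r x' r'. \<bar>r\<bar> \<le> B \<Longrightarrow> \<bar>r'\<bar> \<le> B \<Longrightarrow>
     \<bar>r - r'\<bar> \<le> K * (\<bar>x - x'\<bar> + \<bar>fst (g 0 (x, r)) - fst (g 0 (x', r'))\<bar>)"
    using link.radius_lipschitz[of B 0] by blast
  have one: "fst (g 0 (angle_hull 0 t, snd (hull_orbit t 0))) = angle_hull 1 t" for t
  proof -
    have "hull_orbit t (0 + 1) = g 0 (hull_orbit t 0)" using hull_orbit(1) unfolding orbit_def by blast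
    then show ?thesis using hull_orbit(2)[of t 1] by (simp flip: hull_orbit(2))
  qed
  show ?thesis
  proof (rule locally_bounded_variation_monotone[OF hull_mono[of 0] hull_mono[of 1] _ \<open>0 \<le> K\<close>])
    fix s t
    show "\<bar>snd (hull_orbit s 0) - snd (hull_orbit t 0)\<bar> \<le> K * (\<bar>angle_hull 0 s - angle_hull 0 t\<bar> + \<bar>angle_hull 1 s - angle_hull 1 t\<bar>)"
      using K[OF hull_orbit(3) hull_orbit(3), of s 0 t 0 "angle_hull 0 s" "angle_hull 0 t"] unfolding one .
  qed
qed

end

section \<open>Invariant monotone curves of every rotation number\<close>

theorem (in twist_chain) exists_conjugacy:
  assumes \<omega>: "of_nat N * \<rho>m < \<omega>" "\<omega> < of_nat N * \<rho>p"
    and F: "\<And>w. orbit w \<Longrightarrow> F (w 0) = w (int N)"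
  shows "\<exists>\<phi> \<eta> :: real \<Rightarrow> real.
      (\<forall>t. \<phi> (t + 1) = \<phi> t + 1 \<and> \<eta> (t + 1) = \<eta> t \<and>
           F (\<phi> t, \<eta> t) = (\<phi> (t + \<omega>), \<eta> (t + \<omega>))) \<and>
      mono \<phi> \<and> (\<omega> \<notin> \<rat> \<longrightarrow> strict_mono \<phi>) \<and>
      locally_bounded_variation \<eta>"
proof -
  obtain z where z: "birkhoff \<omega> z" using exists_birkhoff[OF \<omega>] by blast
  obtain \<delta> where \<delta>: "0 < \<delta>" "of_nat N * (\<rho>m + 2 * \<delta>) < \<omega>" "\<omega> < of_nat N * (\<rho>p - 2 * \<delta>)"
    using gap_around[OF \<omega>] by blast
  obtain B where B: "\<And>\<omega> z n. birkhoff \<omega> z \<Longrightarrow> of_nat N * (\<rho>m + 2 * \<delta>) \<le> \<omega> \<Longrightarrow>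
      \<omega> \<le> of_nat N * (\<rho>p - 2 * \<delta>) \<Longrightarrow> \<bar>snd (z n)\<bar> \<le> B"
    using birkhoff_bounded[OF \<delta>(1)] by blast
  have "\<bar>snd (z n)\<bar> \<le> B" for n
    using \<delta> by (intro B[OF z]) auto
  then interpret bounded_birkhoff g N \<rho>p \<rho>m \<omega> B z
    using z by unfold_locales
  show ?thesis
  proof (intro exI conjI allI impI)
    let ?\<phi> = "\<lambda>t. angle_hull 0 t" and ?\<eta> = "\<lambda>t. snd (hull_orbit t 0)"
    fix t
    have \<phi>: "(?\<phi> s, ?\<eta> s) = hull_orbit s 0" for s using hull_orbit(2)[of s 0] by (metis prod.collapse)
    have 1: "hull_orbit (t + 1) 0 = hull_orbit t 0 + (1, 0)"
      using fun_cong[OF hull_orbit_shift[of t 0 1], of 0] by simp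
    show "?\<phi> (t + 1) = ?\<phi> t + 1" "?\<eta> (t + 1) = ?\<eta> t"
      using 1 by (simp_all add: hull_orbit(2)[symmetric])
    have "F (hull_orbit t 0) = hull_orbit t (int N)" by (rule F[OF hull_orbit(1)])
    also have "\<dots> = hull_orbit (t + \<omega>) 0"
      using fun_cong[OF hull_orbit_shift[of t 1 0], of 0] by (simp flip: zero_prod_def)
    finally show "F (?\<phi> t, ?\<eta> t) = (?\<phi> (t + \<omega>), ?\<eta> (t + \<omega>))" unfolding \<phi> .
  next
    show "mono (angle_hull 0)" by (rule hull_mono)
    show "strict_mono (angle_hull 0)" if "\<omega> \<notin> \<rat>" using that by (rule hull_strict_mono)
    show "locally_bounded_variation (\<lambda>t. snd (hull_orbit t 0))" by (rule radius_bounded_variation)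
  qed
qed

text \<open>In a composition the last map of the list acts first, whence the reversal.\<close>

lemma foldr_comp_along_orbit:
  assumes "\<And>k. k < length fs \<Longrightarrow> w (int k + 1) = (rev fs ! k) (w (int k))"
  shows "foldr (\<circ>) fs id (w 0) = w (int (length fs))"
proof -
  have "k \<le> length fs \<Longrightarrow> foldr (\<circ>) (drop (length fs - k) fs) id (w 0) = w (int k)" for k
  proof (induction k)
    case (Suc k)
    have "drop (length fs - Suc k) fs = fs ! (length fs - Suc k) # drop (length fs - k) fs"
      using Suc.prems Cons_nth_drop_Suc[of "length fs - Suc k" fs] by (simp add: Suc_diff_Suc)
    then show ?case using Suc assms[of k] by (simp add: rev_nth add.commute)
  qed simp
  from this[of "length fs"] show ?thesis by simp
qed

theorem theorem5:
  fixes \<rho>m \<rho>p :: real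
    and fs :: "(real \<times> real \<Rightarrow> real \<times> real) list"
    and F :: "real \<times> real \<Rightarrow> real \<times> real"
    and \<Gamma> :: "int \<Rightarrow> (complex \<times> real) set"
  assumes "\<rho>m < \<rho>p"
    and "\<forall>f \<in> set fs. f \<in> class_P \<rho>p \<rho>m"
    and "F = foldr (\<circ>) fs id"
    and "\<forall>k. invariant_curve (cyl_map F) (\<Gamma> k)"
    and "curves_to_top \<Gamma>"
    and "curves_to_bot \<Gamma>"
  shows "\<forall>\<omega> \<in> {real (length fs) * \<rho>m <..< real (length fs) * \<rho>p}.
    \<exists>\<phi> \<eta> :: real \<Rightarrow> real.
      (\<forall>t. \<phi> (t + 1) = \<phi> t + 1 \<and> \<eta> (t + 1) = \<eta> t \<and>
           F (\<phi> t, \<eta> t) = (\<phi> (t + \<omega>), \<eta> (t + \<omega>))) \<and>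
      mono \<phi> \<and> (\<omega> \<notin> \<rat> \<longrightarrow> strict_mono \<phi>) \<and>
      locally_bounded_variation \<eta>"
proof
  let ?N = "length fs"
  fix \<omega> assume \<omega>: "\<omega> \<in> {real ?N * \<rho>m <..< real ?N * \<rho>p}"
  then have N: "0 < ?N" by (cases fs) auto
  define g where "g n = rev fs ! nat (n mod int ?N)" for n
  interpret twist_chain g ?N \<rho>p \<rho>m
  proof
    fix n
    have "nat (n mod int ?N) < ?N" using N by (simp add: nat_less_iff)
    then have "g n \<in> set fs" unfolding g_def by (metis length_rev nth_mem set_rev)
    then show "g n \<in> class_P \<rho>p \<rho>m" using assms(2) by blast
  qed (use N in \<open>auto simp: g_def\<close>)
  show "\<exists>\<phi> \<eta> :: real \<Rightarrow> real.
      (\<forall>t. \<phi> (t + 1) = \<phi> t + 1 \<and> \<eta> (t + 1) = \<eta> t \<and>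
           F (\<phi> t, \<eta> t) = (\<phi> (t + \<omega>), \<eta> (t + \<omega>))) \<and>
      mono \<phi> \<and> (\<omega> \<notin> \<rat> \<longrightarrow> strict_mono \<phi>) \<and>
      locally_bounded_variation \<eta>"
  proof (rule exists_conjugacy)
    fix w assume w: "orbit w"
    have "w (int k + 1) = (rev fs ! k) (w (int k))" if "k < ?N" for k
      using w[unfolded orbit_def, rule_format, of "int k"] that by (simp add: g_def)
    then show "F (w 0) = w (int ?N)" unfolding assms(3) by (rule foldr_comp_along_orbit)
  qed (use \<omega> in auto)
qed

end
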